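(* Let $n\ge1$ and $\hbar>0$. The Bargmann-Fock representation $\pi$ of $\mathcal{A}_\hbar$ on $\mathfrak{D}$ is injective: if $f\in\mathcal{A}_\hbar$ and $\pi(f)=0$, then $f=0$.
   Context: Conventions: $\mathbb{N}=\{0,1,2,\dots\}$; $z=(z^1,\dots,z^n)$ are the standard holomorphic coordinates on $\mathbb{C}^n$; multiindex notation is the usual componentwise one; $\sum_{N=0}^\infty$ means summation over $N\in\mathbb{N}^n$ and $\sum_{I=0}^R$ summation over $I\in\mathbb{N}^n$ with $I\le R$. For $p\in\mathbb{C}^n$, $f\in C^\infty(\mathbb{C}^n)$, $m\in\mathbb{N}$, $\ell\in\{0,\dots,2^m-1\}$, $R,S\in\mathbb{N}^n$ define recursively, with values in $[0,+\infty]$, $$h^{p,\hbar}_{0,0,R,S}(f)=\sum_{N=0}^\infty\frac{(2\hbar)^{|R|+|S|+|N|}}{N!}\left|\frac{\partial^{|R|+|S|+|N|}f}{\partial z^R\partial\overline{z}^{N+S}}(p)\right|^2,$$ and for $m\ge1$ $$h^{p,\hbar}_{m,\ell,R,S}(f)=\sum_{N=0}^\infty\frac1{N!}\Big(\sum_{I=0}^R\sum_{J=0}^{N+S}\tbinom{R}{I}\tbinom{N+S}{J}h^{p,\hbar}_{m-1,\ell/2,I,J}(f)\Big)^2\quad(\ell\text{ even}),$$ $$h^{p,\hbar}_{m,\ell,R,S}(f)=\sum_{N=0}^\infty\frac1{N!}\Big(\sum_{I=0}^R\sum_{J=0}^{N+S}\tbinom{R}{I}\tbinom{N+S}{J}h^{p,\hbar}_{m-1,(\ell-1)/2,J,I}(f)\Big)^2\quad(\ell\text{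 odd}).$$ Put $\|f\|^{p,\hbar}_{m,\ell,R,S}=\big(h^{p,\hbar}_{m,\ell,R,S}(f)\big)^{1/2^{m+1}}$ and $\widetilde{\mathcal{A}}_{p,\hbar}=\{f\in C^\infty(\mathbb{C}^n)\mid \|f\|^{p,\hbar}_{m,\ell,R,S}<\infty\text{ for all }m,\ell,R,S\}$. Define $\mathcal{A}_{p,\hbar}=\widetilde{\mathcal{A}}_{p,\hbar}/\{f\in C^\infty(\mathbb{C}^n)\mid \mathsf{j}^\infty_pf=0\}$ (quotient by the functions with vanishing $\infty$-jet at $p$), with the topology induced by all the seminorms; it is a Fréchet space. Every class has a unique real-analytic representative, so $\mathcal{A}_{p,\hbar}$ is identified with a subspace of $C^\omega(\mathbb{C}^n)$. The product $f\star^\hbar_{\mathrm{Wick}}g=\sum_{N=0}^\infty\frac{(2\hbar)^{|N|}}{N!}\frac{\partial^{|N|}f}{\partial z^N}\frac{\partial^{|N|}g}{\partial\overline{z}^N}$ converges absolutely in $\mathcal{A}_{p,\hbar}$ and makes it a Fréchet $^*$-algebra with complex conjugation as involution. As a Fréchet $^*$-algebra, $\mathcal{A}_{p,\hbar}$ does not depend on $p$ and is denoted $\mathcal{A}_\hbar$. The map $\Psi:\mathcal{A}_\hbar\to\mathcal{A}_\hbar$, $\Psi_f=\sum_{I=0}^\infty\frac1{I!}\frac{\partial^{|I|}f}{\partial\overline{z}^I}(0)\overline{z}^I$, is a continuous projection with image denoted $\mathfrak{D}$. The Bargmann-Fock representation of $\mathcal{A}_\hbar$ on $\mathfrak{D}$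 is the representation by linear operators $\pi(f):\mathfrak{D}\to\mathfrak{D}$, $\pi(f)\Psi_g=\Psi_{f\star^\hbar_{\mathrm{Wick}}g}$. *)

theory Defs
  imports "HOL-Analysis.Analysis"
begin

text \<open>
  Multiindices over the coordinates \<open>'n\<close> are vectors \<open>nat ^ 'n\<close>; addition and \<open>\<le>\<close> are the
  library's componentwise ones, so \<open>{..R}\<close> is the set of all multiindices below \<open>R\<close>.
\<close>

type_synonym 'n multiindex = "nat ^ 'n"

definition mi_abs :: "'n::finite multiindex \<Rightarrow> nat"
  where "mi_abs N = (\<Sum>i\<in>UNIV. N $ i)"

definition mi_fact :: "'n::finite multiindex \<Rightarrow> nat"
  where "mi_fact N = (\<Prod>i\<in>UNIV. fact (N $ i))"

definition mi_choose :: "'n::finite multiindex \<Rightarrow> 'n multiindex \<Rightarrow> nat"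
  where "mi_choose R I = (\<Prod>i\<in>UNIV. (R $ i) choose (I $ i))"

definition mi_power :: "complex ^ 'n::finite \<Rightarrow> 'n multiindex \<Rightarrow> complex"
  where "mi_power z N = (\<Prod>i\<in>UNIV. (z $ i) ^ (N $ i))"

definition cnj_vec :: "complex ^ 'n \<Rightarrow> complex ^ 'n"
  where "cnj_vec z = (\<chi> i. cnj (z $ i))"


text \<open>
  Smoothness and differentiability are meant in the real sense, with \<open>complex ^ 'n\<close> regarded as
  a real vector space of dimension \<open>2 * CARD('n)\<close>.
\<close>

primrec C_k :: "nat \<Rightarrow> ('a::euclidean_space \<Rightarrow> 'b::real_normed_vector) \<Rightarrow> bool" where
  "C_k 0 f \<longleftrightarrow> continuous_on UNIV f"
| "C_k (Suc k) f \<longleftrightarrow>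
     f differentiable_on UNIV \<and> (\<forall>v. C_k k (\<lambda>x. frechet_derivative f (at x) v))"

definition C_infinity :: "('a::euclidean_space \<Rightarrow> 'b::real_normed_vector) \<Rightarrow> bool"
  where "C_infinity f \<longleftrightarrow> (\<forall>k. C_k k f)"

text \<open>
  Real-analyticity in the \<open>2 * CARD('n)\<close> real coordinates: since these are linear combinations
  of the \<open>z$i\<close> and \<open>cnj (z$i)\<close> and vice versa, a locally absolutely convergent power series in
  the former is the same as one in the latter.
\<close>

definition real_analytic :: "(complex ^ 'n::finite \<Rightarrow> complex) \<Rightarrow> bool"
  where "real_analytic f \<longleftrightarrow>
    (\<forall>p. \<exists>r>0. \<exists>a. \<forall>w. norm w < r \<longrightarrow>
      ((\<lambda>(R :: 'n multiindex, S :: 'n multiindex).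
          a R S * mi_power w R * mi_power (cnj_vec w) S) has_sum f (p + w)) UNIV)"


text \<open>
  Wirtinger operators: \<open>axis i 1\<close> and \<open>axis i \<i>\<close> are the directions of the real and imaginary
  part of the \<open>i\<close>-th coordinate.
\<close>

definition d_z :: "'n::finite \<Rightarrow> (complex ^ 'n \<Rightarrow> complex) \<Rightarrow> complex ^ 'n \<Rightarrow> complex"
  where "d_z i f = (\<lambda>p. (frechet_derivative f (at p) (axis i 1)
                          - \<i> * frechet_derivative f (at p) (axis i \<i>)) / 2)"

definition d_zbar :: "'n::finite \<Rightarrow> (complex ^ 'n \<Rightarrow> complex) \<Rightarrow> complex ^ 'n \<Rightarrow> complex"
  where "d_zbar i f = (\<lambda>p. (frechet_derivative f (at p) (axis i 1)
                             + \<i> * frechet_derivative f (at p) (axis i \<i>)) / 2)"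

text \<open>
  The coordinates are differentiated in an arbitrary fixed order, which is immaterial for smooth
  functions because their partial derivatives commute.
\<close>

definition coordinates :: "'n::finite list"
  where "coordinates = (SOME is. distinct is \<and> set is = UNIV)"

definition mi_diff :: "('n::finite \<Rightarrow> 'f \<Rightarrow> 'f) \<Rightarrow> 'n multiindex \<Rightarrow> 'f \<Rightarrow> 'f"
  where "mi_diff D N f = foldr (\<lambda>i. D i ^^ (N $ i)) coordinates f"

definition wirtinger ::
    "'n::finite multiindex \<Rightarrow> 'n multiindex \<Rightarrow> (complex ^ 'n \<Rightarrow> complex) \<Rightarrow> complex ^ 'n \<Rightarrow> complex"
  where "wirtinger R S f = mi_diff d_z R (mi_diff d_zbar S f)"


text \<open>
  \<open>wick_h p hbar f m l R S\<close> for \<open>l < 2 ^ m\<close>.  Infinite sums in \<open>ennreal\<close> always exist, so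
  the value is \<open>\<infinity>\<close> exactly when one of the series involved diverges.
\<close>

primrec wick_h :: "complex ^ 'n::finite \<Rightarrow> real \<Rightarrow> (complex ^ 'n \<Rightarrow> complex) \<Rightarrow> nat \<Rightarrow> nat \<Rightarrow>
    'n multiindex \<Rightarrow> 'n multiindex \<Rightarrow> ennreal" where
  "wick_h p hbar f 0 = (\<lambda>l R S.
     \<Sum>\<^sub>\<infinity>N::'n multiindex.
       ennreal ((2 * hbar) ^ (mi_abs R + mi_abs S + mi_abs N) / real (mi_fact N)
                 * (norm (wirtinger R (N + S) f p))\<^sup>2))"
| "wick_h p hbar f (Suc m) = (\<lambda>l R S.
     \<Sum>\<^sub>\<infinity>N::'n multiindex.
       ennreal (1 / real (mi_fact N))
       * (\<Sum>I\<in>{..R}. \<Sum>J\<in>{..N + S}.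
            of_nat (mi_choose R I) * of_nat (mi_choose (N + S) J)
            * (if even l then wick_h p hbar f m (l div 2) I J
               else wick_h p hbar f m ((l - 1) div 2) J I))\<^sup>2)"

definition wick_seminorm :: "complex ^ 'n::finite \<Rightarrow> real \<Rightarrow> nat \<Rightarrow> nat \<Rightarrow>
    'n multiindex \<Rightarrow> 'n multiindex \<Rightarrow> (complex ^ 'n \<Rightarrow> complex) \<Rightarrow> ennreal"
  where "wick_seminorm p hbar m l R S f =
    (let h = wick_h p hbar f m l R S
     in if h = \<infinity> then \<infinity> else ennreal (root (2 ^ (m + 1)) (enn2real h)))"

definition wick_pre_algebra :: "complex ^ 'n::finite \<Rightarrow> real \<Rightarrow> (complex ^ 'n \<Rightarrow> complex) set"
  where "wick_pre_algebra p hbar =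
    {f. C_infinity f \<and>
        (\<forall>m. \<forall>l\<in>{0..2 ^ m - 1}. \<forall>R S. wick_seminorm p hbar m l R S f < \<infinity>)}"

text \<open>
  The Frechet algebra at \<open>p\<close> is the quotient of \<open>wick_pre_algebra p hbar\<close> by the functions with
  vanishing infinite jet at \<open>p\<close>.  Every class contains exactly one real-analytic function, and
  the algebra is realised here by these representatives.
\<close>

definition wick_algebra_at :: "complex ^ 'n::finite \<Rightarrow> real \<Rightarrow> (complex ^ 'n \<Rightarrow> complex) set"
  where "wick_algebra_at p hbar = {f \<in> wick_pre_algebra p hbar. real_analytic f}"

text \<open>The algebra does not depend on the base point; the origin is used.\<close>

definition wick_algebra :: "real \<Rightarrow> (complex ^ 'n::finite \<Rightarrow> complex) set"
  where "wick_algebra hbar = wick_algebra_at 0 hbar"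

text \<open>
  The series converges absolutely in the Frechet topology; as point evaluations are continuous,
  its limit is the pointwise sum.
\<close>

definition wick_star :: "real \<Rightarrow> (complex ^ 'n::finite \<Rightarrow> complex) \<Rightarrow> (complex ^ 'n \<Rightarrow> complex)
    \<Rightarrow> complex ^ 'n \<Rightarrow> complex"
  where "wick_star hbar f g = (\<lambda>z.
    \<Sum>\<^sub>\<infinity>N::'n multiindex.
      of_real ((2 * hbar) ^ mi_abs N / real (mi_fact N))
      * wirtinger N 0 f z * wirtinger 0 N g z)"

definition Psi :: "(complex ^ 'n::finite \<Rightarrow> complex) \<Rightarrow> complex ^ 'n \<Rightarrow> complex"
  where "Psi f = (\<lambda>z.
    \<Sum>\<^sub>\<infinity>I::'n multiindex.
      of_real (1 / real (mi_fact I)) * wirtinger 0 I f 0 * mi_power (cnj_vec z) I)"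

definition fock_space :: "real \<Rightarrow> (complex ^ 'n::finite \<Rightarrow> complex) set"
  where "fock_space hbar = Psi ` wick_algebra hbar"

text \<open>
  The operator determined on \<open>fock_space hbar\<close> by \<open>\<pi>(f) (Psi g) = Psi (wick_star hbar f g)\<close>:
  \<open>inv_into\<close> picks a preimage \<open>g\<close> of \<open>u\<close> under \<open>Psi\<close>.  The result does not depend on the choice
  because the kernel of \<open>Psi\<close> is a left ideal.
\<close>

definition bargmann_fock :: "real \<Rightarrow> (complex ^ 'n::finite \<Rightarrow> complex) \<Rightarrow>
    (complex ^ 'n \<Rightarrow> complex) \<Rightarrow> complex ^ 'n \<Rightarrow> complex"
  where "bargmann_fock hbar f u =
    Psi (wick_star hbar f (inv_into (wick_algebra hbar) Psi u))"

end

(*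
  Write f = sum of a K Q z^K zbar^Q near the origin.  For each K the algebra contains zbar^K, so
  there is g in the algebra whose antiholomorphic part is zbar^K, and pi(f) = 0 says that the
  purely antiholomorphic Taylor coefficients of the Wick product of f and g vanish.  The
  coefficient of zbar^Q is a sum over Q' <= Q of multiples of a (K - Q') (Q - Q'), in which a K Q
  occurs with a nonzero factor, so induction on the size of K gives a = 0, and f = 0 by
  the identity theorem.

  The preimage g is arbitrary apart from its antiholomorphic part, so the series of the Wick product
  has to be shown to converge near the origin and to admit termwise differentiation.  The seminorm
  with m = l = 1 and R = S = 0 suffices: its finiteness bounds a K Q by
  C * c ^ (mi_abs K + mi_abs Q) / (K! ^ (3/4) * Q! ^ (1/2)), and then the five-fold series of the
  product is dominated by a product of series of the form sum of y ^ mi_abs N / N! ^ (1/4).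
*)

theory Submission
  imports Defs
begin

subsection \<open>Multiindices\<close>

text \<open>Why \<open>m = l = 1\<close>: level 0 controls the jet of \<open>f\<close> at the origin
  only along the antiholomorphic index, with a constant that depends on the holomorphic one. For odd
  \<open>l\<close> the recursion exchanges the two indices, so the outer sum of level 1 runs over
  the holomorphic index and the dependence becomes a factorial. The price is a fourth power: up to
  exponentials, derivatives have size \<open>M! ^ (1/4) * N! ^ (1/2)\<close>. The
  \<open>N\<close>-th term of the Wick product contains a holomorphic derivative of \<open>f\<close>
  and an antiholomorphic derivative of \<open>g\<close>, both of order \<open>N\<close>, hence
  growth \<open>N! ^ (1/4 + 1/2)\<close> against the weight \<open>1 / N!\<close>. That the
  exponents add up to less than 1 makes the product converge, and the slack of 1/4 absorbs every
  exponential, so the bases 2, 4, 16 below are not optimised. The seminorms and \<open>Psi\<close>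
  see only the jet at 0; the argument therefore takes place among Taylor coefficients at the origin,
  and only the identity theorem leaves it.\<close>

lemma
  fixes \<phi> :: "'n::finite \<Rightarrow> nat \<Rightarrow> 'c::{real_normed_field,banach}"
  shows sum_atMost_prod_vec:
      "(\<Sum>J\<in>{..K}. \<Prod>i\<in>UNIV. \<phi> i (J $ i)) = (\<Prod>i\<in>UNIV. \<Sum>j\<le>K $ i. \<phi> i j)"
    and finite_atMost_multiindex: "finite {..K :: 'n multiindex}"
proof -
  let ?P = "PiE UNIV (\<lambda>i. {..K $ i})"
  have bij: "bij_betw vec_lambda ?P {..K}"
    by (rule bij_betwI[where g = vec_nth]) (auto simp: less_eq_vec_def PiE_iff)
  have fin: "finite ?P"
    by (intro finite_PiE) auto
  then show "finite {..K}"
    using bij bij_betw_finite by blast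
  have "(\<Sum>J\<in>{..K}. \<Prod>i\<in>UNIV. \<phi> i (J $ i)) = (\<Sum>g\<in>?P. \<Prod>i\<in>UNIV. \<phi> i (g i))"
    by (subst sum.reindex_bij_betw[OF bij, symmetric]) simp
  also have "\<dots> = (\<Prod>i\<in>UNIV. \<Sum>j\<le>K $ i. \<phi> i j)"
    \<comment> \<open>Over finite index sets \<open>infsum\<close> is \<open>sum\<close>; the law
      for infinite sums brings in the type class of \<open>\<phi>\<close>.\<close>
    using infsum_prod_PiE[of UNIV \<phi> "\<lambda>i. {..K $ i}"] fin by simp
  finally show "(\<Sum>J\<in>{..K}. \<Prod>i\<in>UNIV. \<phi> i (J $ i)) = (\<Prod>i\<in>UNIV. \<Sum>j\<le>K $ i. \<phi> i j)" .
qed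

lemma mi_binomial:
  fixes x y :: "'n::finite \<Rightarrow> 'c::{real_normed_field,banach}"
  shows "(\<Prod>i\<in>UNIV. (x i + y i) ^ (K $ i)) =
    (\<Sum>J\<in>{..K}. of_nat (mi_choose K J) * (\<Prod>i\<in>UNIV. x i ^ (J $ i)) * (\<Prod>i\<in>UNIV. y i ^ (K $ i - J $ i)))"
  using sum_atMost_prod_vec[of "\<lambda>i j. of_nat (K $ i choose j) * x i ^ j * y i ^ (K $ i - j)" K]
  by (simp add: binomial_ring mi_choose_def prod.distrib)

lemma power_mi_abs: "c ^ mi_abs N = (\<Prod>i\<in>UNIV. c ^ (N $ i))" for c :: "'c::comm_monoid_mult"
  by (simp add: mi_abs_def power_sum)

text \<open>For the binomial sums in the recursion of \<open>wick_h\<close>.\<close>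

lemma sum_mi_choose_power:
  "(\<Sum>J\<in>{..K}. real (mi_choose K J) * c ^ mi_abs J) = (1 + c) ^ mi_abs K"
  using mi_binomial[of "\<lambda>_. c" "\<lambda>_. 1" K] by (simp add: power_mi_abs add.commute)

text \<open>A finite set of multiindices lies in a box \<open>{..K}\<close>, with the entrywise sum
  of its members as \<open>K\<close>; on a box the sum factors into partial sums of the one-variable
  series.\<close>

lemma summable_on_prod_vec:
  fixes \<phi> :: "nat \<Rightarrow> real"
  assumes nonneg: "\<And>k. 0 \<le> \<phi> k" and "summable \<phi>"
  shows "(\<lambda>N :: 'n::finite multiindex. \<Prod>i\<in>UNIV. \<phi> (N $ i)) summable_on UNIV"
proof (rule nonneg_bdd_above_summable_on)
  show "bdd_above (sum (\<lambda>N :: 'n multiindex. \<Prod>i\<in>UNIV. \<phi> (N $ i)) ` {F. F \<subseteq> UNIV \<and> finite F})"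
  proof (rule bdd_aboveI2)
    fix F :: "'n multiindex set" assume "F \<in> {F. F \<subseteq> UNIV \<and> finite F}"
    then have fin: "finite F" by simp
    define K :: "'n multiindex" where "K = (\<chi> i. \<Sum>N\<in>F. N $ i)"
    have "F \<subseteq> {..K}"
      using fin by (auto simp: less_eq_vec_def K_def intro: member_le_sum)
    then have "(\<Sum>N\<in>F. \<Prod>i\<in>UNIV. \<phi> (N $ i)) \<le> (\<Sum>N\<in>{..K}. \<Prod>i\<in>UNIV. \<phi> (N $ i))"
      by (intro sum_mono2 finite_atMost_multiindex prod_nonneg) (auto simp: nonneg)
    also have "\<dots> = (\<Prod>i\<in>UNIV. \<Sum>j\<le>K $ i. \<phi> j)"
      by (rule sum_atMost_prod_vec)
    also have "\<dots> \<le> (\<Prod>i\<in>(UNIV :: 'n set). suminf \<phi>)"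
      using assms by (intro prod_mono conjI sum_nonneg sum_le_suminf) auto
    finally show "(\<Sum>N\<in>F. \<Prod>i\<in>UNIV. \<phi> (N $ i)) \<le> (\<Prod>i\<in>(UNIV :: 'n set). suminf \<phi>)" .
  qed
qed (auto intro: prod_nonneg nonneg)

section \<open>Arithmetic of multiindices, factorials and monomials\<close>

lemma mi_abs_add: "mi_abs (M + N) = mi_abs M + mi_abs N"
  by (simp add: mi_abs_def sum.distrib)

lemma mi_abs_0 [simp]: "mi_abs 0 = 0"
  by (simp add: mi_abs_def)

lemma mi_abs_pos: "N \<noteq> 0 \<Longrightarrow> 0 < mi_abs N"
  by (auto simp: mi_abs_def vec_eq_iff sum_eq_0_iff intro!: Nat.gr0I)

lemma mi_fact_pos [simp]: "0 < mi_fact N"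
  by (simp add: mi_fact_def prod_pos)

lemma mi_fact_neq_0 [simp]: "mi_fact N \<noteq> 0"
  using mi_fact_pos[of N] by linarith

lemma mi_fact_0 [simp]: "mi_fact 0 = 1"
  by (simp add: mi_fact_def)

lemma mi_fact_add_axis: "mi_fact (R + axis i 1) = Suc (R $ i) * mi_fact R"
proof -
  have "mi_fact (R + axis i 1) = (\<Prod>j\<in>UNIV. (if j = i then Suc (R $ i) else 1) * fact (R $ j))"
    unfolding mi_fact_def by (intro prod.cong) (auto simp: axis_def)
  then show ?thesis
    by (simp add: prod.distrib mi_fact_def)
qed

text \<open>In each coordinate the quotient of the factorials is a binomial coefficient, hence at
  most a power of 2.\<close>

lemma mi_fact_add_le: "mi_fact (M + N) \<le> 2 ^ (mi_abs M + mi_abs N) * (mi_fact M * mi_fact N)"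
proof -
  have 1: "fact (m + n) \<le> (2::nat) ^ (m + n) * (fact m * fact n)" for m n :: nat
  proof -
    have "fact (m + n) = ((m + n) choose m) * (fact m * fact n)"
      using binomial_fact_lemma[of m "m + n"] by (simp add: mult_ac)
    also have "\<dots> \<le> 2 ^ (m + n) * (fact m * fact n)"
      by (intro mult_right_mono binomial_le_pow2) auto
    finally show ?thesis .
  qed
  show ?thesis
    unfolding mi_abs_add[symmetric] power_mi_abs mi_fact_def prod.distrib[symmetric]
    by (intro prod_mono) (auto intro: 1)
qed

lemma mi_power_0 [simp]: "mi_power z 0 = 1"
  by (simp add: mi_power_def)

lemma mi_power_add: "mi_power z (M + N) = mi_power z M * mi_power z N"
  by (simp add: mi_power_def power_add prod.distrib)

lemma mi_power_zero: "mi_power 0 N = (if N = 0 then 1 else 0)"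
  by (auto simp: mi_power_def vec_eq_iff)

lemma norm_mi_power_le:
  assumes "\<And>i. norm (z $ i) \<le> t"
  shows "norm (mi_power z N) \<le> t ^ mi_abs N"
  unfolding mi_power_def power_mi_abs prod_norm[symmetric]
  using assms by (intro prod_mono) (auto simp: norm_power intro!: power_mono)

lemma mi_power_const: "mi_power (\<chi> i. c) N = c ^ mi_abs N"
  by (simp add: mi_power_def power_mi_abs)

lemma norm_cnj_vec_nth [simp]: "norm (cnj_vec z $ i) = norm (z $ i)"
  by (simp add: cnj_vec_def)

lemma cnj_vec_0 [simp]: "cnj_vec 0 = 0"
  by (simp add: cnj_vec_def vec_eq_iff)

lemma cnj_vec_add: "cnj_vec (z + w) = cnj_vec z + cnj_vec w"
  by (simp add: cnj_vec_def vec_eq_iff)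

subsection \<open>Termwise differentiation of power series\<close>

text \<open>Keeps \<open>axis i 1\<close> in the form in which the shift lemmas match it, instead of
  \<open>axis i (Suc 0)\<close>.\<close>

declare One_nat_def [simp del]

text \<open>The partial derivative of \<open>mi_power z R\<close> in the coordinate
  \<open>z $ i\<close>. At \<open>R $ i = 0\<close> the truncated exponent is harmless, since the
  leading factor is 0.\<close>

definition mi_dpower :: "'n::finite \<Rightarrow> complex ^ 'n \<Rightarrow> 'n multiindex \<Rightarrow> complex"
  where "mi_dpower i z R = of_nat (R $ i) * (z $ i) ^ (R $ i - 1) * (\<Prod>j\<in>UNIV - {i}. (z $ j) ^ (R $ j))"

lemma multiindex_pos_decomp:
  fixes R :: "'n::finite multiindex"
  assumes "R $ i \<noteq> 0"
  obtains R' where "R = R' + axis i 1"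
proof
  show "R = (\<chi> j. if j = i then R $ i - 1 else R $ j) + axis i 1"
    using assms by (auto simp: vec_eq_iff axis_def)
qed

lemma mi_dpower_add_axis: "mi_dpower i z (R + axis i 1) = of_nat (Suc (R $ i)) * mi_power z R"
proof -
  have "(\<Prod>j\<in>UNIV - {i}. (z $ j) ^ ((R + axis i 1) $ j)) = (\<Prod>j\<in>UNIV - {i}. (z $ j) ^ (R $ j))"
    by (intro prod.cong) (auto simp: axis_def)
  then show ?thesis
    unfolding mi_dpower_def mi_power_def
    by (simp add: prod.remove[of UNIV i])
qed

lemma mi_dpower_eq_0: "R $ i = 0 \<Longrightarrow> mi_dpower i z R = 0"
  by (simp add: mi_dpower_def)

lemma norm_mi_dpower_le:
  assumes "\<And>i. norm (z $ i) \<le> t"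
  shows "norm (mi_dpower i z R) \<le> real (R $ i) * t ^ (mi_abs R - 1)"
proof (cases "R $ i = 0")
  case False
  then obtain R' where R': "R = R' + axis i 1"
    by (rule multiindex_pos_decomp)
  moreover have "mi_abs (axis i 1 :: 'a multiindex) = 1"
    by (simp add: mi_abs_def axis_def)
  moreover have "R $ i = Suc (R' $ i)"
    by (simp add: R')
  ultimately show ?thesis
    using mult_left_mono[OF norm_mi_power_le[OF assms, of R'], of "1 + real (R' $ i)"]
      norm_of_nat[where 'a = complex, of "Suc (R' $ i)"]
    by (simp add: mi_dpower_add_axis norm_mult mi_abs_add add.commute)
qed (simp add: mi_dpower_eq_0)

lemma has_derivative_mi_power:
  "((\<lambda>z. mi_power z R) has_derivative (\<lambda>h. \<Sum>i\<in>UNIV. h $ i * mi_dpower i z R)) (at z within S)"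
  unfolding mi_power_def mi_dpower_def
  by (auto intro!: derivative_eq_intros sum.cong simp: fun_eq_iff mult_ac
      bounded_linear.has_derivative[OF bounded_linear_vec_nth])

lemma bounded_linear_cnj_vec: "bounded_linear (cnj_vec :: complex ^ 'n::finite \<Rightarrow> complex ^ 'n)"
  unfolding cnj_vec_def
  by (intro linear_conv_bounded_linear[THEN iffD1] linearI) (auto simp: vec_eq_iff)

lemma has_derivative_mi_power_cnj:
  "((\<lambda>z. mi_power (cnj_vec z) R) has_derivative
    (\<lambda>h. \<Sum>i\<in>UNIV. cnj (h $ i) * mi_dpower i (cnj_vec z) R)) (at z within S)"
proof -
  have "((\<lambda>z. mi_power (cnj_vec z) R) has_derivative
    (\<lambda>h. \<Sum>i\<in>UNIV. cnj_vec h $ i * mi_dpower i (cnj_vec z) R)) (at z within S)"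
    by (rule has_derivative_compose[OF bounded_linear_imp_has_derivative[OF bounded_linear_cnj_vec]
          has_derivative_mi_power])
  then show ?thesis
    by (simp add: cnj_vec_def)
qed

lemma norm_sum_mi_dpower_le:
  assumes "\<And>i. norm (z $ i) \<le> t" and "\<And>i. norm (w i) \<le> c"
  shows "norm (\<Sum>i\<in>UNIV. w i * mi_dpower i z R) \<le> c * (real (mi_abs R) * t ^ (mi_abs R - 1))"
proof -
  have c: "0 \<le> c"
    using assms(2) norm_ge_zero order_trans by blast
  have "norm (\<Sum>i\<in>UNIV. w i * mi_dpower i z R) \<le> (\<Sum>i\<in>UNIV. c * (real (R $ i) * t ^ (mi_abs R - 1)))"
    using norm_mi_dpower_le[of z t, OF assms(1)] assms(2) c
    by (intro sum_norm_le) (simp only: norm_mult, intro mult_mono, auto)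
  also have "\<dots> = c * (real (mi_abs R) * t ^ (mi_abs R - 1))"
    by (simp add: mi_abs_def sum_distrib_left sum_distrib_right)
  finally show ?thesis .
qed

text \<open>Stands in for a Cauchy estimate: the derivative of a power at radius \<open>t\<close> is
  bounded by the power at a larger radius \<open>u\<close>, at the cost of
  \<open>1 / (u - t)\<close>.\<close>

lemma of_nat_mult_power_le:
  fixes t u :: real
  assumes "0 \<le> t" "t \<le> u"
  shows "real k * t ^ (k - 1) * (u - t) \<le> u ^ k"
proof (induction k)
  case (Suc k)
  have "real k * t ^ k * (u - t) \<le> t * u ^ k"
  proof (cases k)
    case (Suc j)
    then show ?thesis
      using mult_left_mono[OF Suc.IH \<open>0 \<le> t\<close>] by (simp add: mult_ac)
  qed (use assms in auto)
  moreover have "t ^ k * (u - t) \<le> u ^ k * (u - t)"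
    using assms by (intro mult_right_mono power_mono) auto
  ultimately show ?case
    by (simp add: algebra_simps)
qed simp

text \<open>Weierstrass test for derivatives. Enumerating the indices by \<open>nat\<close> turns
  unordered sums into series, so that \<open>has_derivative_series\<close> applies; the uniform
  convergence it asks for comes from the tails of the majorant \<open>M\<close>.\<close>

lemma has_derivative_has_sum:
  fixes F :: "'i \<Rightarrow> 'a::real_normed_vector \<Rightarrow> 'b::banach"
  assumes cnt: "countable (UNIV :: 'i set)" and inf: "infinite (UNIV :: 'i set)"
    and S: "open S" "convex S" "x \<in> S"
    and f: "\<And>y. y \<in> S \<Longrightarrow> ((\<lambda>k. F k y) has_sum f y) UNIV"
    and F': "\<And>k y. y \<in> S \<Longrightarrow> (F k has_derivative F' k y) (at y)"
    and M: "M summable_on UNIV" "\<And>k y h. y \<in> S \<Longrightarrow> norm (F' k y h) \<le> M k * norm h"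
  shows "\<exists>f'. (f has_derivative f') (at x) \<and> (\<forall>h. ((\<lambda>k. F' k x h) has_sum f' h) UNIV)"
proof -
  obtain e :: "nat \<Rightarrow> 'i" where e: "bij_betw e UNIV UNIV"
    using bij_betw_from_nat_into[OF cnt inf] by blast
  define g' where "g' y h = (\<Sum>\<^sub>\<infinity>k. F' k y h)" for y h
  have g': "((\<lambda>k. F' k y h) has_sum g' y h) UNIV" if "y \<in> S" for y h
    unfolding g'_def
    using Infinite_Sum.abs_summable_on_comparison_test'[OF summable_on_cmult_left[OF M(1)] M(2)[OF that]]
    by (intro has_sum_infsum, rule abs_summable_summable)
  have sums: "(\<lambda>n. G (e n)) sums s" if "(G has_sum s) UNIV" for G :: "'i \<Rightarrow> 'b" and s
    by (rule has_sum_imp_sums) (simp add: has_sum_reindex_bij_betw[OF e] that)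
  have Msum: "summable (\<lambda>n. M (e n))"
    by (rule summable_on_imp_summable) (simp add: summable_on_reindex_bij_betw[OF e] M(1))
  have "\<exists>g. \<forall>y\<in>S. (\<lambda>n. F (e n) y) sums g y \<and> (g has_derivative g' y) (at y within S)"
  proof (rule has_derivative_series[where x = x and l = "f x"])
    fix \<epsilon> :: real assume "\<epsilon> > 0"
    then have "\<forall>\<^sub>F n in sequentially. norm (\<Sum>i. M (e (i + n))) < \<epsilon>"
      using suminf_exist_split[OF \<open>\<epsilon> > 0\<close> Msum] by (simp add: eventually_sequentially)
    then show "\<forall>\<^sub>F n in sequentially. \<forall>y\<in>S. \<forall>h. norm ((\<Sum>i<n. F' (e i) y h) - g' y h) \<le> \<epsilon> * norm h"
    proof (rule eventually_mono, intro ballI allI)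
      fix n y h assume n: "norm (\<Sum>i. M (e (i + n))) < \<epsilon>" and y: "y \<in> S"
      note s = sums[OF g'[OF y], of h] and Mn = summable_ignore_initial_segment[OF Msum, of n]
      have "g' y h - (\<Sum>i<n. F' (e i) y h) = (\<Sum>i. F' (e (i + n)) y h)"
        using suminf_minus_initial_segment[OF sums_summable[OF s], of n] sums_unique[OF s] by simp
      also have "norm \<dots> \<le> (\<Sum>i. M (e (i + n)) * norm h)"
        by (intro norm_suminf_le M(2)[OF y] summable_mult2 Mn)
      also have "\<dots> = (\<Sum>i. M (e (i + n))) * norm h"
        by (rule suminf_mult2[OF Mn, symmetric])
      also have "\<dots> \<le> \<epsilon> * norm h"
        using n by (intro mult_right_mono) auto
      finally show "norm ((\<Sum>i<n. F' (e i) y h) - g' y h) \<le> \<epsilon> * norm h"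
        by (simp add: norm_minus_commute)
    qed
  next
    show "(\<lambda>n. F (e n) x) sums f x"
      by (rule sums[OF f[OF \<open>x \<in> S\<close>]])
  next
    fix n y assume "y \<in> S"
    then show "(F (e n) has_derivative F' (e n) y) (at y within S)"
      by (rule has_derivative_at_withinI[OF F'])
  qed (use S in auto)
  then obtain g where "\<forall>y\<in>S. (\<lambda>n. F (e n) y) sums g y \<and> (g has_derivative g' y) (at y within S)"
    by (elim exE)
  then have g: "\<And>y. y \<in> S \<Longrightarrow> (\<lambda>n. F (e n) y) sums g y"
    "\<And>y. y \<in> S \<Longrightarrow> (g has_derivative g' y) (at y within S)"
    by auto
  \<comment> \<open>\<open>has_derivative_series\<close> supplies its own limit \<open>g\<close>,
    known to agree with \<open>f\<close> only on \<open>S\<close>; hence the transfer within the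
    open set below.\<close>
  have eq: "g y = f y" if "y \<in> S" for y
    using sums_unique2[OF g(1)[OF that] sums[OF f[OF that]]] .
  have "(g has_derivative g' x) (at x)"
    using g(2)[OF \<open>x \<in> S\<close>] by (simp only: at_within_open[OF S(3,1)])
  from has_derivative_transform_within_open[OF this S(1) S(3) eq] g'[OF \<open>x \<in> S\<close>] show ?thesis
    by (intro exI[of _ "g' x"] conjI allI)
qed

section \<open>Power series in \<open>z\<close> and \<open>cnj_vec z\<close> on polydiscs\<close>

definition polydisc :: "real \<Rightarrow> (complex ^ 'n::finite) set"
  where "polydisc r = {z. \<forall>i. norm (z $ i) < r}"

text \<open>Polydiscs rather than balls, because they contain the corner with all coordinates equal
  to \<open>t\<close>, whose terms dominate those at all points of the polydisc of radius
  \<open>t\<close>. The centre is always 0; other centres are reached by translating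
  \<open>f\<close>.\<close>

definition has_pseries :: "(complex ^ 'n::finite \<Rightarrow> complex) \<Rightarrow>
    ('n multiindex \<Rightarrow> 'n multiindex \<Rightarrow> complex) \<Rightarrow> real \<Rightarrow> bool"
  where "has_pseries f a r \<longleftrightarrow> r > 0 \<and> (\<forall>z\<in>polydisc r.
    ((\<lambda>(R, S). a R S * mi_power z R * mi_power (cnj_vec z) S) has_sum f z) UNIV)"

lemma open_polydisc: "open (polydisc r)"
proof -
  have "polydisc r = (\<Inter>i. {z :: complex ^ 'a. norm (z $ i) < r})"
    by (auto simp: polydisc_def)
  moreover have "open {z :: complex ^ 'a. norm (z $ i) < r}" for i
    by (intro open_Collect_less continuous_intros)
  ultimately show ?thesis
    by auto
qed

lemma convex_polydisc: "convex (polydisc r)"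
proof -
  have "polydisc r = (\<Inter>i. (\<lambda>z :: complex ^ 'a. z $ i) -` ball 0 r)"
    by (auto simp: polydisc_def)
  then show ?thesis
    by (auto intro!: convex_INT convex_linear_vimage simp: linear_iff)
qed

lemma zero_in_polydisc: "0 < r \<Longrightarrow> 0 \<in> polydisc r"
  by (simp add: polydisc_def)

text \<open>Evaluate at the corner, which is its own conjugate; unordered summability of complex
  families is absolute.\<close>

lemma has_pseries_abs_summable:
  assumes "has_pseries f a r" "0 \<le> t" "t < r"
  shows "(\<lambda>(R, S). norm (a R S) * t ^ (mi_abs R + mi_abs S)) summable_on UNIV"
proof -
  let ?z = "(\<chi> i. of_real t) :: complex ^ 'a"
  have "?z \<in> polydisc r"
    using assms by (simp add: polydisc_def)
  then have "(\<lambda>(R, S). a R S * mi_power ?z R * mi_power (cnj_vec ?z) S) summable_on UNIV"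
    using assms(1) has_sum_imp_summable unfolding has_pseries_def by blast
  then have "(\<lambda>x. norm (case x of (R, S) \<Rightarrow> a R S * mi_power ?z R * mi_power (cnj_vec ?z) S)) summable_on UNIV"
    by (simp only: summable_on_iff_abs_summable_on_complex)
  moreover have "cnj_vec ?z = ?z"
    by (simp add: cnj_vec_def vec_eq_iff)
  ultimately show ?thesis
    using assms(2) by (simp add: mi_power_const case_prod_unfold norm_mult norm_power power_add mult_ac)
qed

lemma infinite_multiindex_pairs: "infinite (UNIV :: ('n::finite multiindex \<times> 'n multiindex) set)"
proof -
  have "inj (\<lambda>k::nat. ((\<chi> i. k, 0) :: 'n multiindex \<times> 'n multiindex))"
    by (auto simp: inj_on_def vec_eq_iff)
  then show ?thesis
    using infinite_iff_countable_subset by blast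
qed

lemma has_pseries_has_derivative:
  fixes z :: "complex ^ 'n::finite"
  assumes f: "has_pseries f a r" and z: "z \<in> polydisc r"
  obtains f' where "(f has_derivative f') (at z)"
    and "\<And>h. ((\<lambda>(R, S). a R S *
        (mi_power z R * (\<Sum>i\<in>UNIV. cnj (h $ i) * mi_dpower i (cnj_vec z) S)
          + (\<Sum>i\<in>UNIV. h $ i * mi_dpower i z R) * mi_power (cnj_vec z) S)) has_sum f' h) UNIV"
proof -
  define m where "m = Max (range (\<lambda>i. norm (z $ i)))"
  have m: "norm (z $ i) \<le> m" for i
    by (simp add: m_def)
  have "m \<in> range (\<lambda>i. norm (z $ i))"
    unfolding m_def by (intro Max_in) auto
  then have "0 \<le> m" "m < r"
    using z by (auto simp: polydisc_def)
  \<comment> \<open>Points range over the polydisc of radius \<open>t\<close>, the majorant is taken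
    at radius \<open>u\<close>, and \<open>u < r\<close> makes it summable.\<close>
  then obtain t u where tu: "m < t" "t < u" "u < r"
    using dense by metis
  define F where "F = (\<lambda>(R, S) y. a R S * (mi_power y R * mi_power (cnj_vec y) S))"
  define F' where "F' = (\<lambda>(R, S) y h. a R S *
        (mi_power y R * (\<Sum>i\<in>UNIV. cnj (h $ i) * mi_dpower i (cnj_vec y) S)
          + (\<Sum>i\<in>UNIV. h $ i * mi_dpower i y R) * mi_power (cnj_vec y) S))"
  \<comment> \<open>Each of the two terms of the product rule costs one factor
    \<open>1 / (u - t)\<close>.\<close>
  define M where "M = (\<lambda>(R, S). norm (a R S) * u ^ (mi_abs R + mi_abs S) * (2 / (u - t)))"
  have "\<exists>f'. (f has_derivative f') (at z) \<and> (\<forall>h. ((\<lambda>k. F' k z h) has_sum f' h) UNIV)"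
  proof (rule has_derivative_has_sum[where M = M])
    show "open (polydisc t :: (complex ^ 'n) set)" "convex (polydisc t :: (complex ^ 'n) set)"
      by (rule open_polydisc convex_polydisc)+
    show "z \<in> polydisc t"
      using m tu by (auto simp: polydisc_def intro: le_less_trans)
    show "M summable_on UNIV"
      using summable_on_cmult_left[OF has_pseries_abs_summable[OF f, of u], of "2 / (u - t)"]
        \<open>0 \<le> m\<close> tu by (simp add: M_def case_prod_unfold)
  next
    fix k and y :: "complex ^ 'n" assume y: "y \<in> polydisc t"
    then have "y \<in> polydisc r"
      using tu by (auto simp: polydisc_def intro: less_trans)
    then show "((\<lambda>k. F k y) has_sum f y) UNIV"
      using f by (simp add: has_pseries_def F_def case_prod_unfold mult.assoc)
    show "(F k has_derivative F' k y) (at y)"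
      unfolding F_def F'_def case_prod_unfold
      by (intro has_derivative_mult_right has_derivative_mult has_derivative_mi_power
          has_derivative_mi_power_cnj)
    fix h :: "complex ^ 'n"
    obtain R S where k: "k = (R, S)" by force
    have yt: "norm (y $ i) \<le> t" "norm (cnj_vec y $ i) \<le> t" for i
      using y by (auto simp: polydisc_def intro: less_imp_le)
    have hn: "norm (h $ i) \<le> norm h" "norm (cnj (h $ i)) \<le> norm h" for i
      by (simp_all add: Finite_Cartesian_Product.norm_nth_le)
    have t0: "0 \<le> t" using \<open>0 \<le> m\<close> tu by simp
    have d: "norm h * (real l * t ^ (l - 1)) \<le> norm h * (u ^ l / (u - t))" for l
      using of_nat_mult_power_le[of t u l] t0 tu by (intro mult_left_mono) (auto simp: field_simps)
    have p: "t ^ l \<le> u ^ l" for l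
      using t0 tu by (intro power_mono) auto
    have 1: "norm (\<Sum>i\<in>UNIV. cnj (h $ i) * mi_dpower i (cnj_vec y) S) \<le> norm h * (u ^ mi_abs S / (u - t))"
      by (rule order_trans[OF norm_sum_mi_dpower_le d]) (use yt hn in auto)
    have 2: "norm (\<Sum>i\<in>UNIV. h $ i * mi_dpower i y R) \<le> norm h * (u ^ mi_abs R / (u - t))"
      by (rule order_trans[OF norm_sum_mi_dpower_le d]) (use yt hn in auto)
    have 3: "norm (mi_power y R) \<le> u ^ mi_abs R" "norm (mi_power (cnj_vec y) S) \<le> u ^ mi_abs S"
      by (rule order_trans[OF norm_mi_power_le p], use yt in auto)+
    have 4: "norm (mi_power y R * (\<Sum>i\<in>UNIV. cnj (h $ i) * mi_dpower i (cnj_vec y) S))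
        \<le> u ^ mi_abs R * (norm h * (u ^ mi_abs S / (u - t)))"
      unfolding norm_mult using t0 tu by (intro mult_mono[OF 3(1) 1]) auto
    have 5: "norm ((\<Sum>i\<in>UNIV. h $ i * mi_dpower i y R) * mi_power (cnj_vec y) S)
        \<le> norm h * (u ^ mi_abs R / (u - t)) * u ^ mi_abs S"
      unfolding norm_mult using t0 tu by (intro mult_mono[OF 2 3(2)]) auto
    have "norm (F' k y h) \<le> norm (a R S) *
        (u ^ mi_abs R * (norm h * (u ^ mi_abs S / (u - t))) + norm h * (u ^ mi_abs R / (u - t)) * u ^ mi_abs S)"
      unfolding k F'_def split norm_mult
      by (rule mult_left_mono[OF order_trans[OF norm_triangle_ineq add_mono[OF 4 5]] norm_ge_zero])
    then show "norm (F' k y h) \<le> M k * norm h"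
      by (simp add: k M_def power_add mult_ac)
  qed (use infinite_multiindex_pairs in auto)
  then show thesis
    using that unfolding F'_def case_prod_unfold by auto
qed

subsection \<open>Wirtinger derivatives and the identity theorem\<close>

lemma has_pseriesD:
  "has_pseries f a r \<Longrightarrow> z \<in> polydisc r \<Longrightarrow>
    ((\<lambda>(R, S). a R S * mi_power z R * mi_power (cnj_vec z) S) has_sum f z) UNIV"
  by (simp add: has_pseries_def)

lemma sum_axis_mult:
  fixes c :: complex
  shows "(\<Sum>j\<in>UNIV. axis i c $ j * w j) = c * w i"
    and "(\<Sum>j\<in>UNIV. cnj (axis i c $ j) * w j) = cnj c * w i"
proof -
  have "(\<Sum>j\<in>UNIV. axis i c $ j * w j) = (\<Sum>j\<in>UNIV. if j = i then c * w i else 0)"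
    by (intro sum.cong) (auto simp: axis_def)
  then show "(\<Sum>j\<in>UNIV. axis i c $ j * w j) = c * w i"
    by simp
  have "(\<Sum>j\<in>UNIV. cnj (axis i c $ j) * w j) = (\<Sum>j\<in>UNIV. if j = i then cnj c * w i else 0)"
    by (intro sum.cong) (auto simp: axis_def)
  then show "(\<Sum>j\<in>UNIV. cnj (axis i c $ j) * w j) = cnj c * w i"
    by simp
qed

text \<open>Reindexing after a differentiation: terms with exponent 0 vanish, and the remaining
  indices are the image of the injective shift by \<open>axis i 1\<close>.\<close>

lemma has_sum_shift_multiindex:
  fixes F :: "'n::finite multiindex \<times> 'n multiindex \<Rightarrow> 'c::{comm_monoid_add,topological_space}"
  shows "(\<And>R S. R $ i = 0 \<Longrightarrow> F (R, S) = 0) \<Longrightarrow> (F has_sum s) UNIV \<Longrightarrow>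
      ((\<lambda>(R, S). F (R + axis i 1, S)) has_sum s) UNIV"
    and "(\<And>R S. S $ i = 0 \<Longrightarrow> F (R, S) = 0) \<Longrightarrow> (F has_sum s) UNIV \<Longrightarrow>
      ((\<lambda>(R, S). F (R, S + axis i 1)) has_sum s) UNIV"
proof -
  assume 0: "\<And>R S. R $ i = 0 \<Longrightarrow> F (R, S) = 0" and s: "(F has_sum s) UNIV"
  let ?h = "\<lambda>(R, S). (R + axis i 1 :: 'n multiindex, S :: 'n multiindex)"
  have inj: "inj ?h"
    by (auto simp: inj_on_def)
  have "F x = 0" if "x \<notin> range ?h" for x
  proof (cases x)
    case (Pair R S)
    have "R $ i = 0"
    proof (rule ccontr)
      assume "R $ i \<noteq> 0"
      then obtain R' where "R = R' + axis i 1"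
        by (rule multiindex_pos_decomp)
      then have "x = ?h (R', S)"
        by (simp add: Pair)
      then show False
        using that by blast
    qed
    then show ?thesis
      by (simp add: Pair 0)
  qed
  then have "(F has_sum s) (range ?h)"
    using s has_sum_cong_neutral[of UNIV "range ?h" F F s] by auto
  then show "((\<lambda>(R, S). F (R + axis i 1, S)) has_sum s) UNIV"
    unfolding has_sum_reindex[OF inj] by (simp add: o_def case_prod_unfold)
next
  assume 0: "\<And>R S. S $ i = 0 \<Longrightarrow> F (R, S) = 0" and s: "(F has_sum s) UNIV"
  let ?h = "\<lambda>(R, S). (R :: 'n multiindex, S + axis i 1 :: 'n multiindex)"
  have inj: "inj ?h"
    by (auto simp: inj_on_def)
  have "F x = 0" if "x \<notin> range ?h" for x
  proof (cases x)
    case (Pair R S)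
    have "S $ i = 0"
    proof (rule ccontr)
      assume "S $ i \<noteq> 0"
      then obtain S' where "S = S' + axis i 1"
        by (rule multiindex_pos_decomp)
      then have "x = ?h (R, S')"
        by (simp add: Pair)
      then show False
        using that by blast
    qed
    then show ?thesis
      by (simp add: Pair 0)
  qed
  then have "(F has_sum s) (range ?h)"
    using s has_sum_cong_neutral[of UNIV "range ?h" F F s] by auto
  then show "((\<lambda>(R, S). F (R, S + axis i 1)) has_sum s) UNIV"
    unfolding has_sum_reindex[OF inj] by (simp add: o_def case_prod_unfold)
qed

text \<open>Along \<open>axis i c\<close> the derivative is \<open>c\<close> times the holomorphic
  part plus \<open>cnj c\<close> times the antiholomorphic part. Taking \<open>c = 1\<close> and
  \<open>c = \<i>\<close>, each Wirtinger combination cancels one of the two.\<close>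

lemma
  assumes f: "has_pseries f a r"
  shows has_pseries_d_z: "has_pseries (d_z i f) (\<lambda>R S. of_nat (Suc (R $ i)) * a (R + axis i 1) S) r"
    and has_pseries_d_zbar: "has_pseries (d_zbar i f) (\<lambda>R S. of_nat (Suc (S $ i)) * a R (S + axis i 1)) r"
proof -
  have *: "((\<lambda>(R, S). of_nat (Suc (R $ i)) * a (R + axis i 1) S * mi_power z R * mi_power (cnj_vec z) S)
      has_sum d_z i f z) UNIV \<and>
    ((\<lambda>(R, S). of_nat (Suc (S $ i)) * a R (S + axis i 1) * mi_power z R * mi_power (cnj_vec z) S)
      has_sum d_zbar i f z) UNIV" if z: "z \<in> polydisc r" for z
  proof -
    obtain f' where f': "(f has_derivative f') (at z)"
      and H: "\<And>h. ((\<lambda>(R, S). a R S *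
        (mi_power z R * (\<Sum>i\<in>UNIV. cnj (h $ i) * mi_dpower i (cnj_vec z) S)
          + (\<Sum>i\<in>UNIV. h $ i * mi_dpower i z R) * mi_power (cnj_vec z) S)) has_sum f' h) UNIV"
      using has_pseries_has_derivative[OF f z] by blast
    have fd: "frechet_derivative f (at z) = f'"
      using frechet_derivative_at[OF f'] by simp
    note H1 = H[of "axis i 1", unfolded sum_axis_mult]
    note H2 = has_sum_cmult_right[OF H[of "axis i \<i>", unfolded sum_axis_mult], of \<i>]
    define G where "G = (\<lambda>(R, S). a R S * (mi_dpower i z R * mi_power (cnj_vec z) S))"
    define G' where "G' = (\<lambda>(R, S). a R S * (mi_power z R * mi_dpower i (cnj_vec z) S))"
    have "(G has_sum d_z i f z) UNIV"
      using has_sum_cmult_right[OF has_sum_add[OF H1 has_sum_uminusI[OF H2]], of "1 / 2"]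
      by (rule iffD1[OF arg_cong2[where f = "\<lambda>g s. (g has_sum s) UNIV"], rotated 2])
        (auto simp: G_def d_z_def fd fun_eq_iff field_simps)
    then have 1: "((\<lambda>(R, S). G (R + axis i 1, S)) has_sum d_z i f z) UNIV"
      by (rule has_sum_shift_multiindex(1)[rotated]) (simp add: G_def mi_dpower_eq_0)
    have "(G' has_sum d_zbar i f z) UNIV"
      using has_sum_cmult_right[OF has_sum_add[OF H1 H2], of "1 / 2"]
      by (rule iffD1[OF arg_cong2[where f = "\<lambda>g s. (g has_sum s) UNIV"], rotated 2])
        (auto simp: G'_def d_zbar_def fd fun_eq_iff field_simps)
    then have 2: "((\<lambda>(R, S). G' (R, S + axis i 1)) has_sum d_zbar i f z) UNIV"
      by (rule has_sum_shift_multiindex(2)[rotated]) (simp add: G'_def mi_dpower_eq_0)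
    from 1 2 show ?thesis
      by (simp add: G_def G'_def mi_dpower_add_axis mult_ac del: of_nat_Suc)
  qed
  then show "has_pseries (d_z i f) (\<lambda>R S. of_nat (Suc (R $ i)) * a (R + axis i 1) S) r"
    "has_pseries (d_zbar i f) (\<lambda>R S. of_nat (Suc (S $ i)) * a R (S + axis i 1)) r"
    using f by (auto simp: has_pseries_def)
qed

text \<open>The order in \<open>coordinates\<close> is chosen by \<open>SOME\<close>. The induction
  therefore treats any distinct list, and \<open>P\<close> records the multiindex restricted to its
  entries.\<close>

lemma mi_diff_induct:
  fixes N :: "'n::finite multiindex"
  assumes base: "P 0 f" and step: "\<And>i M g. P M g \<Longrightarrow> P (M + axis i 1) (D i g)"
  shows "P N (mi_diff D N f)"
proof -
  have pow: "P (M + axis i k) ((D i ^^ k) g)" if "P M g" for i M g k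
  proof (induction k)
    case (Suc k)
    have "axis i (Suc k) = axis i k + axis i (1 :: nat)"
      by (simp add: vec_eq_iff axis_def)
    then show ?case
      using step[OF Suc] by (simp add: add.assoc)
  next
    case 0
    have "axis i (0 :: nat) = 0"
      by (simp add: vec_eq_iff axis_def)
    with that show ?case
      by (simp only: add_0_right funpow_0)
  qed
  have *: "P (\<chi> i. if i \<in> set L then N $ i else 0) (foldr (\<lambda>i. D i ^^ (N $ i)) L f)" if "distinct L" for L
    using that
  proof (induction L)
    case Nil
    show ?case using base by (simp add: zero_vec_def)
  next
    case (Cons i L)
    have "(\<chi> j. if j \<in> set (i # L) then N $ j else 0)
        = (\<chi> j. if j \<in> set L then N $ j else 0) + axis i (N $ i)"
      using Cons.prems by (auto simp: vec_eq_iff axis_def)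
    then show ?case
      using pow[OF Cons.IH] Cons.prems by simp
  qed
  have "\<exists>L. distinct L \<and> set L = (UNIV :: 'n set)"
    using finite_distinct_list[OF finite] by blast
  then have c: "distinct (coordinates :: 'n list)" "set (coordinates :: 'n list) = UNIV"
    unfolding coordinates_def by (metis (mono_tags, lifting) someI_ex)+
  show ?thesis
    using *[OF c(1)] c(2) by (simp add: mi_diff_def)
qed

text \<open>Falling factorials are written as quotients of factorials, the form to which the
  estimates on \<open>qfact\<close> apply.\<close>

definition pseries_diff :: "'n::finite multiindex \<Rightarrow> 'n multiindex \<Rightarrow>
    ('n multiindex \<Rightarrow> 'n multiindex \<Rightarrow> complex) \<Rightarrow> 'n multiindex \<Rightarrow> 'n multiindex \<Rightarrow> complex"
  where "pseries_diff M N a R S =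
    of_nat (mi_fact (R + M)) / of_nat (mi_fact R) * (of_nat (mi_fact (S + N)) / of_nat (mi_fact S))
      * a (R + M) (S + N)"

lemma pseries_diff_0 [simp]: "pseries_diff 0 0 a = a"
  by (simp add: pseries_diff_def fun_eq_iff)

lemma pseries_diff_add_axis:
  "pseries_diff (M + axis i 1) N a = (\<lambda>R S. of_nat (Suc (R $ i)) * pseries_diff M N a (R + axis i 1) S)"
  "pseries_diff M (N + axis i 1) a = (\<lambda>R S. of_nat (Suc (S $ i)) * pseries_diff M N a R (S + axis i 1))"
  by (simp_all add: pseries_diff_def fun_eq_iff mi_fact_add_axis add_ac del: of_nat_Suc mult_Suc)

lemma has_pseries_wirtinger:
  assumes "has_pseries f a r"
  shows "has_pseries (wirtinger M N f) (pseries_diff M N a) r"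
proof -
  have "has_pseries (mi_diff d_zbar N f) (pseries_diff 0 N a) r"
    by (rule mi_diff_induct[where P = "\<lambda>M g. has_pseries g (pseries_diff 0 M a) r"])
      (simp_all only: assms pseries_diff_0 pseries_diff_add_axis has_pseries_d_zbar)
  then show ?thesis
    unfolding wirtinger_def
    by (rule mi_diff_induct[where P = "\<lambda>M g. has_pseries g (pseries_diff M N a) r"])
      (simp only: pseries_diff_add_axis has_pseries_d_z)
qed

lemma has_pseries_at_0:
  assumes "has_pseries f a r"
  shows "f 0 = a 0 0"
proof -
  have "0 \<in> polydisc r"
    using assms by (simp add: has_pseries_def zero_in_polydisc)
  from has_pseriesD[OF assms this]
  have "((\<lambda>x. case x of (R, S) \<Rightarrow> a R S * mi_power 0 R * mi_power 0 S) has_sum f 0) UNIV"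
    by simp
  moreover have "((\<lambda>x. case x of (R, S) \<Rightarrow> a R S * mi_power 0 R * mi_power 0 S) has_sum a 0 0) UNIV"
    by (rule has_sum_finite_neutralI[of "{(0, 0)}"]) (auto simp: mi_power_zero split: if_splits)
  ultimately show ?thesis
    by (rule has_sum_unique)
qed

lemma wirtinger_at_0:
  assumes "has_pseries f a r"
  shows "wirtinger M N f 0 = of_nat (mi_fact M * mi_fact N) * a M N"
  using has_pseries_at_0[OF has_pseries_wirtinger[OF assms]] by (simp add: pseries_diff_def)

text \<open>Both families are read off the same jet at 0, so the radii may differ.\<close>

lemma has_pseries_unique:
  assumes "has_pseries f a r" "has_pseries f b s"
  shows "a = b"
  using wirtinger_at_0[OF assms(1)] wirtinger_at_0[OF assms(2)] by (simp add: fun_eq_iff)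

section \<open>The identity theorem for real-analytic functions\<close>

lemma wirtinger_eq_0_on_open:
  assumes "open W" "\<And>z. z \<in> W \<Longrightarrow> f z = 0" "z \<in> W"
  shows "wirtinger M N f z = 0"
proof -
  have der: "\<forall>z\<in>W. d_z i g z = 0 \<and> d_zbar i g z = 0" if g: "\<forall>z\<in>W. g z = 0" for i g
  proof
    fix z assume z: "z \<in> W"
    have "(g has_derivative (\<lambda>_. 0)) (at z)"
      by (rule has_derivative_transform_within_open[OF has_derivative_const[of 0] \<open>open W\<close> z])
        (simp add: g)
    then have "frechet_derivative g (at z) = (\<lambda>_. 0)"
      by (rule frechet_derivative_at[symmetric])
    then show "d_z i g z = 0 \<and> d_zbar i g z = 0"
      by (simp add: d_z_def d_zbar_def)
  qed
  have "\<forall>z\<in>W. mi_diff d_zbar N f z = 0"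
    by (rule mi_diff_induct[where P = "\<lambda>_ g. \<forall>z\<in>W. g z = 0"]) (use der assms(2) in auto)
  then have "\<forall>z\<in>W. wirtinger M N f z = 0"
    unfolding wirtinger_def
    by (rule mi_diff_induct[where P = "\<lambda>_ g. \<forall>z\<in>W. g z = 0"]) (use der in auto)
  then show ?thesis
    using assms(3) by blast
qed

lemma has_pseries_isCont:
  assumes "has_pseries f a r" "z \<in> polydisc r"
  shows "isCont f z"
  by (rule has_pseries_has_derivative[OF assms]) (rule has_derivative_continuous)

text \<open>Connects the Euclidean balls in \<open>real_analytic\<close> with the polydiscs in
  \<open>has_pseries\<close>.\<close>

lemma polydisc_subset_ball: "polydisc (r / real CARD('n)) \<subseteq> ball (0 :: complex ^ 'n::finite) r"
proof
  fix z :: "complex ^ 'n" assume z: "z \<in> polydisc (r / real CARD('n))"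
  have "norm z \<le> (\<Sum>i\<in>UNIV. norm (z $ i))"
    by (simp add: norm_vec_def L2_set_le_sum)
  also have "\<dots> < (\<Sum>i\<in>(UNIV :: 'n set). r / real CARD('n))"
    using z by (intro sum_strict_mono) (auto simp: polydisc_def)
  finally show "z \<in> ball 0 r"
    by simp
qed

lemma real_analytic_has_pseries:
  fixes f :: "complex ^ 'n::finite \<Rightarrow> complex"
  assumes "real_analytic f"
  obtains a r where "has_pseries (\<lambda>w. f (p + w)) a r"
proof -
  have "\<exists>r>0. \<exists>a. \<forall>w. norm w < r \<longrightarrow>
      ((\<lambda>(R, S). a R S * mi_power w R * mi_power (cnj_vec w) S) has_sum f (p + w)) UNIV"
    using assms unfolding real_analytic_def by (rule spec)
  then obtain r a where r: "r > 0" and *: "\<forall>w. norm w < r \<longrightarrow>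
      ((\<lambda>(R, S). a R S * mi_power w R * mi_power (cnj_vec w) S) has_sum f (p + w)) UNIV"
    by (elim exE conjE)
  have "has_pseries (\<lambda>w. f (p + w)) a (r / real CARD('n))"
    unfolding has_pseries_def
  proof (intro conjI ballI)
    fix w :: "complex ^ 'n" assume "w \<in> polydisc (r / real CARD('n))"
    then have "norm w < r"
      using polydisc_subset_ball[of r] by auto
    then show "((\<lambda>(R, S). a R S * mi_power w R * mi_power (cnj_vec w) S) has_sum f (p + w)) UNIV"
      using * by blast
  qed (use r in simp)
  then show thesis
    by (rule that)
qed

text \<open>The interior \<open>Z\<close> of the zero set is open and closed. At a limit point
  \<open>q\<close> of \<open>Z\<close> all Wirtinger derivatives vanish, by continuity from the
  points of \<open>Z\<close>, so the expansion around \<open>q\<close> is zero and \<open>q\<close>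
  is interior as well.\<close>

theorem real_analytic_identity:
  fixes f :: "complex ^ 'n::finite \<Rightarrow> complex"
  assumes an: "real_analytic f" and 0: "\<And>M N. wirtinger M N f 0 = 0"
  shows "f = (\<lambda>_. 0)"
proof -
  define Z where "Z = \<Union>{W. open W \<and> (\<forall>z\<in>W. f z = 0)}"
  have "open Z"
    by (auto simp: Z_def)
  have local0: "p \<in> Z" if "\<And>M N. wirtinger M N (\<lambda>w. f (p + w)) 0 = 0" for p
  proof -
    obtain a r where ps: "has_pseries (\<lambda>w. f (p + w)) a r"
      using real_analytic_has_pseries[OF an] .
    have "a M N = 0" for M N
      using wirtinger_at_0[OF ps] that by simp
    then have *: "f (p + w) = 0" if "w \<in> polydisc r" for w
      using has_sum_unique[OF has_pseriesD[OF ps that], of 0] by (simp add: case_prod_unfold)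
    have "open ((+) p ` polydisc r)"
      by (intro open_translation open_polydisc)
    moreover have "p \<in> (+) p ` polydisc r"
      using ps zero_in_polydisc[of r] by (force simp: has_pseries_def)
    ultimately show ?thesis
      unfolding Z_def using * by (intro UnionI[of "(+) p ` polydisc r"]) auto
  qed
  have "closed Z"
    unfolding closed_limpt
  proof (intro allI impI)
    fix q assume q: "q islimpt Z"
    obtain a r where ps: "has_pseries (\<lambda>w. f (q + w)) a r"
      using real_analytic_has_pseries[OF an] .
    show "q \<in> Z"
    proof (rule local0)
      fix M N
      let ?g = "wirtinger M N (\<lambda>w. f (q + w))"
      have g0: "?g w = 0" if "q + w \<in> Z" for w
      proof -
        obtain W where W: "open W" "q + w \<in> W" "\<forall>z\<in>W. f z = 0"
          using \<open>q + w \<in> Z\<close> by (auto simp: Z_def)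
        have "open ((+) q -` W)"
          using W(1) by (intro open_vimage continuous_intros)
        then show ?thesis
          by (rule wirtinger_eq_0_on_open) (use W in auto)
      qed
      have "isCont ?g 0"
        using has_pseries_isCont[OF has_pseries_wirtinger[OF ps]] ps
        by (simp add: has_pseries_def zero_in_polydisc)
      then have cont: "((\<lambda>w. ?g (w - q)) \<longlongrightarrow> ?g 0) (at q within Z)"
        by (intro isCont_tendsto_compose[of 0 ?g]) (auto intro!: tendsto_eq_intros)
      have "((\<lambda>w. ?g (w - q)) \<longlongrightarrow> 0) (at q within Z)"
        by (rule tendsto_eventually) (auto simp: eventually_at_filter g0)
      then show "?g 0 = 0"
        by (rule tendsto_unique[OF _ cont, rotated]) (use q in \<open>simp add: trivial_limit_within\<close>)
    qed
  qed
  have "0 \<in> Z"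
    using local0[of 0] 0 by simp
  then have "Z = UNIV"
    using \<open>open Z\<close> \<open>closed Z\<close> clopen[of Z] by auto
  then show ?thesis
    by (auto simp: Z_def fun_eq_iff set_eq_iff)
qed

subsection \<open>Antiholomorphic monomials\<close>

text \<open>The product rule in \<open>C_k_mult\<close> multiplies derivatives by undifferentiated
  factors, which are then needed at level \<open>k\<close> while they are given at level
  \<open>Suc k\<close>.\<close>

lemma C_k_decr: "C_k (Suc k) f \<Longrightarrow> C_k k f"
proof (induction k arbitrary: f)
  case 0
  then show ?case
    by (simp add: differentiable_imp_continuous_on)
next
  case (Suc k)
  have "f differentiable_on UNIV" "C_k (Suc k) (\<lambda>x. frechet_derivative f (at x) v)" for v
    using Suc.prems C_k.simps(2)[of "Suc k" f] by blast+
  then show ?case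
    unfolding C_k.simps(2)[of k f] using Suc.IH by blast
qed

lemma C_k_SucI:
  assumes der: "\<And>x. (f has_derivative f' x) (at x)" and "\<And>v. C_k k (\<lambda>x. f' x v)"
  shows "C_k (Suc k) f"
proof -
  have "f differentiable_on UNIV"
    using der by (auto simp: differentiable_on_def intro: differentiableI)
  moreover have "frechet_derivative f (at x) = f' x" for x
    by (rule frechet_derivative_at[OF der, symmetric])
  ultimately show ?thesis
    using assms(2) by simp
qed

lemma C_k_SucD:
  assumes "C_k (Suc k) f"
  shows "(f has_derivative frechet_derivative f (at x)) (at x)" "C_k k (\<lambda>x. frechet_derivative f (at x) v)"
  using assms frechet_derivative_works[of f "at x"] by (auto simp: differentiable_on_def)

lemma C_k_const: "C_k k (\<lambda>_. c)"
proof (induction k arbitrary: c)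
  case (Suc k)
  show ?case
    by (rule C_k_SucI[OF has_derivative_const Suc])
qed simp

lemma C_k_bounded_linear: "bounded_linear f \<Longrightarrow> C_k k f"
  using C_k_SucI[OF bounded_linear_imp_has_derivative C_k_const] C_k_decr by blast

lemma C_k_add: "C_k k f \<Longrightarrow> C_k k g \<Longrightarrow> C_k k (\<lambda>x. f x + g x)"
proof (induction k arbitrary: f g)
  case 0
  then show ?case
    by (simp add: continuous_on_add)
next
  case (Suc k)
  show ?case
    using C_k_SucD(2)[OF Suc.prems(1)] C_k_SucD(2)[OF Suc.prems(2)]
    by (intro C_k_SucI[OF has_derivative_add[OF C_k_SucD(1)[OF Suc.prems(1)] C_k_SucD(1)[OF Suc.prems(2)]]]
        Suc.IH)
qed

lemma C_k_mult:
  fixes f g :: "'a::euclidean_space \<Rightarrow> 'b::real_normed_algebra"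
  shows "C_k k f \<Longrightarrow> C_k k g \<Longrightarrow> C_k k (\<lambda>x. f x * g x)"
proof (induction k arbitrary: f g)
  case 0
  then show ?case
    by (simp add: continuous_on_mult)
next
  case (Suc k)
  show ?case
    using C_k_SucD(2)[OF Suc.prems(1)] C_k_SucD(2)[OF Suc.prems(2)]
      C_k_decr[OF Suc.prems(1)] C_k_decr[OF Suc.prems(2)]
    by (intro C_k_SucI[OF has_derivative_mult[OF C_k_SucD(1)[OF Suc.prems(1)] C_k_SucD(1)[OF Suc.prems(2)]]]
        C_k_add Suc.IH)
qed

lemma C_k_power:
  fixes f :: "'a::euclidean_space \<Rightarrow> 'b::real_normed_algebra_1"
  shows "C_k k f \<Longrightarrow> C_k k (\<lambda>x. f x ^ n)"
  by (induction n) (auto intro: C_k_const C_k_mult)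

lemma C_k_prod:
  fixes f :: "'i \<Rightarrow> 'a::euclidean_space \<Rightarrow> 'b::real_normed_field"
  shows "(\<And>i. i \<in> A \<Longrightarrow> C_k k (f i)) \<Longrightarrow> C_k k (\<lambda>x. \<Prod>i\<in>A. f i x)"
  by (induction A rule: infinite_finite_induct) (auto intro: C_k_const C_k_mult)

lemma C_infinity_mi_power_cnj: "C_infinity (\<lambda>z :: complex ^ 'n::finite. mi_power (cnj_vec z) K)"
proof -
  have "bounded_linear (\<lambda>z :: complex ^ 'n. cnj_vec z $ i)" for i
    by (rule bounded_linear_compose[OF bounded_linear_vec_nth bounded_linear_cnj_vec])
  then show ?thesis
    unfolding C_infinity_def mi_power_def
    by (intro allI C_k_prod C_k_power C_k_bounded_linear)
qed

lemma has_pseries_mi_power_cnj: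
  assumes "r > 0"
  shows "has_pseries (\<lambda>z. mi_power (cnj_vec z) K) (\<lambda>R S. if R = 0 \<and> S = K then 1 else 0) r"
  unfolding has_pseries_def
proof (intro conjI ballI)
  fix z
  show "((\<lambda>(R, S). (if R = 0 \<and> S = K then 1 else 0) * mi_power z R * mi_power (cnj_vec z) S)
      has_sum mi_power (cnj_vec z) K) UNIV"
    by (rule has_sum_finite_neutralI[of "{(0, K)}"]) (auto split: if_splits)
qed (fact assms)

text \<open>Expansions are required around every \<open>p\<close>, so the monomial is re-expanded by
  the binomial theorem; the family has finite support.\<close>

lemma real_analytic_mi_power_cnj: "real_analytic (\<lambda>z :: complex ^ 'n::finite. mi_power (cnj_vec z) K)"
  unfolding real_analytic_def
proof
  fix p :: "complex ^ 'n"
  define a :: "'n multiindex \<Rightarrow> 'n multiindex \<Rightarrow> complex" where "a = (\<lambda>R S. if R = 0 \<and> S \<le> K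
    then of_nat (mi_choose K S) * (\<Prod>i\<in>UNIV. (cnj_vec p $ i) ^ (K $ i - S $ i)) else 0)"
  have "((\<lambda>(R, S). a R S * mi_power w R * mi_power (cnj_vec w) S) has_sum mi_power (cnj_vec (p + w)) K) UNIV"
    for w
  proof (rule has_sum_finite_neutralI[of "{0} \<times> {..K}"])
    have "mi_power (cnj_vec (p + w)) K
      = (\<Sum>J\<in>{..K}. of_nat (mi_choose K J) * mi_power (cnj_vec w) J
          * (\<Prod>i\<in>UNIV. (cnj_vec p $ i) ^ (K $ i - J $ i)))"
      using mi_binomial[of "\<lambda>i. cnj_vec w $ i" "\<lambda>i. cnj_vec p $ i" K]
      by (simp add: mi_power_def cnj_vec_add add.commute)
    also have "\<dots> = (\<Sum>J\<in>{..K}. a 0 J * mi_power w 0 * mi_power (cnj_vec w) J)"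
      by (intro sum.cong) (auto simp: a_def)
    also have "\<dots> = (\<Sum>(R, S)\<in>{0} \<times> {..K}. a R S * mi_power w R * mi_power (cnj_vec w) S)"
      by (subst sum.cartesian_product[symmetric]) simp
    finally show "mi_power (cnj_vec (p + w)) K
      = (\<Sum>(R, S)\<in>{0} \<times> {..K}. a R S * mi_power w R * mi_power (cnj_vec w) S)" .
  qed (auto simp: a_def finite_atMost_multiindex split: if_splits)
  then show "\<exists>r>0. \<exists>a. \<forall>w. norm w < r \<longrightarrow>
      ((\<lambda>(R, S). a R S * mi_power w R * mi_power (cnj_vec w) S) has_sum mi_power (cnj_vec (p + w)) K) UNIV"
    by (intro exI[of _ 1] conjI exI[of _ a]) auto
qed

section \<open>Finiteness of all seminorms on antiholomorphic monomials\<close>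

lemma summable_on_power_div_mi_fact:
  assumes "0 \<le> B"
  shows "(\<lambda>N :: 'n::finite multiindex. B ^ mi_abs N / real (mi_fact N)) summable_on UNIV"
proof -
  have "summable (\<lambda>k. B ^ k / fact k :: real)"
    using summable_exp[of B] by (simp add: field_simps)
  then have "(\<lambda>N :: 'n multiindex. \<Prod>i\<in>UNIV. B ^ (N $ i) / fact (N $ i)) summable_on UNIV"
    using assms by (intro summable_on_prod_vec[where \<phi> = "\<lambda>k. B ^ k / fact k"]) auto
  then show ?thesis
    by (simp add: mi_fact_def power_mi_abs prod_dividef)
qed

lemma infsum_ennreal_le:
  fixes g :: "'i \<Rightarrow> real"
  assumes "\<And>x. f x \<le> ennreal (g x)" "g summable_on UNIV" "\<And>x. 0 \<le> g x"
  shows "infsum f UNIV \<le> ennreal (infsum g UNIV)"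
proof (rule infsum_le_finite_sums)
  fix F :: "'i set" assume F: "finite F"
  have "sum f F \<le> (\<Sum>x\<in>F. ennreal (g x))"
    by (intro sum_mono assms)
  also have "\<dots> = ennreal (sum g F)"
    using assms(3) by (simp add: sum_ennreal)
  also have "\<dots> \<le> ennreal (infsum g UNIV)"
    using assms F by (intro ennreal_leI finite_sum_le_infsum) auto
  finally show "sum f F \<le> ennreal (infsum g UNIV)" .
qed (simp add: nonneg_summable_on_complete)

text \<open>
  A bound of the shape \<open>C * A ^ (mi_abs R + mi_abs S)\<close> survives the recursion: the binomial sums
  turn \<open>A\<close> into \<open>1 + A\<close>, and the factor \<open>1 / N!\<close> beats the resulting exponential in \<open>N\<close>.
\<close>

lemma wick_h_geometric_bound:
  fixes f :: "complex ^ 'n::finite \<Rightarrow> complex"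
  assumes base: "\<And>l R S. wick_h p hbar f 0 l R S \<le> ennreal C0"
  shows "\<exists>A\<ge>0. \<exists>C\<ge>0. \<forall>l R S. wick_h p hbar f m l R S \<le> ennreal (C * A ^ (mi_abs R + mi_abs S))"
proof (induction m)
  case 0
  have "wick_h p hbar f 0 l R S \<le> ennreal (max 0 C0 * 1 ^ (mi_abs R + mi_abs S))" for l R S
    using order_trans[OF base ennreal_leI[of C0 "max 0 C0"]] by simp
  then show ?case
    by (intro exI[of _ 1] conjI exI[of _ "max 0 C0"] allI) auto
next
  case (Suc m)
  then obtain A C where AC: "0 \<le> A" "0 \<le> C"
    and h: "\<And>l R S. wick_h p hbar f m l R S \<le> ennreal (C * A ^ (mi_abs R + mi_abs S))"
    by (elim exE conjE) blast
  \<comment> \<open>The inner sums produce the base \<open>1 + A\<close>, and the recursion squares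
    them.\<close>
  define B where "B = (1 + A)\<^sup>2"
  define E where "E = (\<Sum>\<^sub>\<infinity>N :: 'n multiindex. B ^ mi_abs N / real (mi_fact N))"
  have "wick_h p hbar f (Suc m) l R S \<le> ennreal (C\<^sup>2 * E * B ^ (mi_abs R + mi_abs S))" for l R S
  proof -
    \<comment> \<open>The inductive bound is symmetric in its two indices, so the exchange for odd
      \<open>l\<close> leaves it intact.\<close>
    define g where "g I J = (if even l then wick_h p hbar f m (l div 2) I J
       else wick_h p hbar f m ((l - 1) div 2) J I)" for I J
    have g: "g I J \<le> ennreal (C * A ^ (mi_abs I + mi_abs J))" for I J
      using h[of "l div 2" I J] h[of "(l - 1) div 2" J I] by (auto simp: g_def add.commute)
    have inner: "(\<Sum>I\<in>{..R}. \<Sum>J\<in>{..N + S}. of_nat (mi_choose R I) * of_nat (mi_choose (N + S) J) * g I J)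
        \<le> ennreal (C * (1 + A) ^ (mi_abs R + mi_abs S + mi_abs N))" for N
    proof -
      have "(\<Sum>I\<in>{..R}. \<Sum>J\<in>{..N + S}. of_nat (mi_choose R I) * of_nat (mi_choose (N + S) J) * g I J)
        \<le> (\<Sum>I\<in>{..R}. \<Sum>J\<in>{..N + S}. ennreal (C * ((real (mi_choose R I) * A ^ mi_abs I)
            * (real (mi_choose (N + S) J) * A ^ mi_abs J))))"
      proof (intro sum_mono)
        fix I J
        have "of_nat (mi_choose R I) * of_nat (mi_choose (N + S) J) * g I J \<le>
          of_nat (mi_choose R I) * of_nat (mi_choose (N + S) J) * ennreal (C * A ^ (mi_abs I + mi_abs J))"
          by (intro mult_left_mono g) simp
        also have "\<dots> = ennreal (C * ((real (mi_choose R I) * A ^ mi_abs I)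
            * (real (mi_choose (N + S) J) * A ^ mi_abs J)))"
          using AC by (simp add: ennreal_of_nat_eq_real_of_nat ennreal_mult[symmetric] power_add mult_ac)
        finally show "of_nat (mi_choose R I) * of_nat (mi_choose (N + S) J) * g I J \<le> \<dots>" .
      qed
      also have "\<dots> = ennreal (\<Sum>I\<in>{..R}. \<Sum>J\<in>{..N + S}. C * ((real (mi_choose R I) * A ^ mi_abs I)
            * (real (mi_choose (N + S) J) * A ^ mi_abs J)))"
        using AC by (simp add: sum_ennreal sum_nonneg)
      also have "(\<Sum>I\<in>{..R}. \<Sum>J\<in>{..N + S}. C * ((real (mi_choose R I) * A ^ mi_abs I)
            * (real (mi_choose (N + S) J) * A ^ mi_abs J)))
          = C * ((\<Sum>I\<in>{..R}. real (mi_choose R I) * A ^ mi_abs I)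
            * (\<Sum>J\<in>{..N + S}. real (mi_choose (N + S) J) * A ^ mi_abs J))"
        by (subst sum_product) (simp only: sum_distrib_left)
      also have "\<dots> = C * ((1 + A) ^ mi_abs R * (1 + A) ^ mi_abs (N + S))"
        by (simp only: sum_mi_choose_power)
      finally show ?thesis
        by (simp add: mi_abs_add power_add mult_ac)
    qed
    have B: "0 \<le> B"
      by (simp add: B_def)
    have "wick_h p hbar f (Suc m) l R S = (\<Sum>\<^sub>\<infinity>N. ennreal (1 / real (mi_fact N)) *
        (\<Sum>I\<in>{..R}. \<Sum>J\<in>{..N + S}. of_nat (mi_choose R I) * of_nat (mi_choose (N + S) J) * g I J)\<^sup>2)"
      by (simp add: g_def)
    also have "\<dots> \<le> ennreal (\<Sum>\<^sub>\<infinity>N :: 'n multiindex.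
        C\<^sup>2 * B ^ (mi_abs R + mi_abs S) * (B ^ mi_abs N / real (mi_fact N)))"
    proof (rule infsum_ennreal_le)
      fix N :: "'n multiindex"
      have "ennreal (1 / real (mi_fact N)) *
          (\<Sum>I\<in>{..R}. \<Sum>J\<in>{..N + S}. of_nat (mi_choose R I) * of_nat (mi_choose (N + S) J) * g I J)\<^sup>2
          \<le> ennreal (1 / real (mi_fact N)) * (ennreal (C * (1 + A) ^ (mi_abs R + mi_abs S + mi_abs N)))\<^sup>2"
        by (intro mult_left_mono power_mono inner) auto
      also have "\<dots> = ennreal (C\<^sup>2 * B ^ (mi_abs R + mi_abs S) * (B ^ mi_abs N / real (mi_fact N)))"
        using AC by (simp add: ennreal_power ennreal_mult[symmetric] B_def power_add power_mult_distrib
            power_mult[symmetric] mult_ac)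
      finally show "ennreal (1 / real (mi_fact N)) *
          (\<Sum>I\<in>{..R}. \<Sum>J\<in>{..N + S}. of_nat (mi_choose R I) * of_nat (mi_choose (N + S) J) * g I J)\<^sup>2 \<le> \<dots>" .
    next
      show "(\<lambda>N :: 'n multiindex. C\<^sup>2 * B ^ (mi_abs R + mi_abs S) * (B ^ mi_abs N / real (mi_fact N)))
          summable_on UNIV"
        by (intro summable_on_cmult_right summable_on_power_div_mi_fact B)
    qed (use B in simp)
    also have "(\<Sum>\<^sub>\<infinity>N :: 'n multiindex. C\<^sup>2 * B ^ (mi_abs R + mi_abs S) * (B ^ mi_abs N / real (mi_fact N)))
        = C\<^sup>2 * B ^ (mi_abs R + mi_abs S) * E"
      unfolding E_def by (rule infsum_cmult_right')
    finally show ?thesis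
      by (simp add: mult_ac)
  qed
  moreover have "0 \<le> B" "0 \<le> C\<^sup>2 * E"
    by (auto simp: B_def E_def intro!: mult_nonneg_nonneg infsum_nonneg)
  ultimately show ?case
    by blast
qed

text \<open>The jet at 0 has a single nonzero entry, at \<open>(0, K)\<close>. It pins
  \<open>N + S\<close> to \<open>K\<close>, so level 0 is bounded uniformly in \<open>R\<close> and
  \<open>S\<close>; \<open>wick_h_geometric_bound\<close> carries this to every level.\<close>

lemma mi_power_cnj_in_wick_algebra:
  fixes K :: "'n::finite multiindex"
  assumes "0 < hbar"
  shows "(\<lambda>z. mi_power (cnj_vec z) K) \<in> wick_algebra hbar"
proof -
  let ?u = "\<lambda>z. mi_power (cnj_vec z) K"
  define C where "C = (2 * hbar) ^ mi_abs K * (real (mi_fact K))\<^sup>2"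
  define t where "t R S N = ennreal ((2 * hbar) ^ (mi_abs R + mi_abs S + mi_abs N) / real (mi_fact N)
                 * (norm (wirtinger R (N + S) ?u 0))\<^sup>2)" for R S N :: "'n multiindex"
  have wirt: "wirtinger R S ?u 0 = (if R = 0 \<and> S = K then of_nat (mi_fact K) else 0)" for R S
    using wirtinger_at_0[OF has_pseries_mi_power_cnj[OF zero_less_one], of R S K] by simp
  have "infsum (t R S) UNIV \<le> ennreal (real (card {..K}) * C)" for R S
  proof -
    have "t R S N = 0" if "N \<notin> {..K}" for N
      using that by (auto simp: t_def wirt less_eq_vec_def)
    then have "infsum (t R S) UNIV = infsum (t R S) {..K}"
      by (intro infsum_cong_neutral) auto
    also have "\<dots> = (\<Sum>N\<in>{..K}. t R S N)"
      by (simp add: finite_atMost_multiindex)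
    also have "\<dots> \<le> (\<Sum>N\<in>{..K}. ennreal C)"
    proof (rule sum_mono)
      fix N :: "'n multiindex"
      have "(2 * hbar) ^ (mi_abs S + mi_abs N) / real (mi_fact N) \<le> (2 * hbar) ^ (mi_abs S + mi_abs N)"
        using frac_le[of "(2 * hbar) ^ (mi_abs S + mi_abs N)" _ 1 "real (mi_fact N)"] assms mi_fact_pos[of N]
        by (simp add: Suc_le_eq del: mi_fact_pos)
      from mult_right_mono[OF this, of "(real (mi_fact K))\<^sup>2"] show "t R S N \<le> ennreal C"
        by (auto simp: t_def wirt C_def mi_abs_add add.commute intro!: ennreal_leI)
    qed
    also have "\<dots> = ennreal (real (card {..K}) * C)"
      using assms by (simp add: C_def ennreal_mult ennreal_of_nat_eq_real_of_nat)
    finally show ?thesis .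
  qed
  then have "wick_h 0 hbar ?u 0 l R S \<le> ennreal (real (card {..K}) * C)" for l R S
    unfolding wick_h.simps t_def .
  from wick_h_geometric_bound[OF this] have "wick_h 0 hbar ?u m l R S < \<infinity>" for m l R S
    by (metis ennreal_less_top infinity_ennreal_def order_le_less_trans)
  then have "wick_seminorm 0 hbar m l R S ?u < \<infinity>" for m l R S
    by (simp add: wick_seminorm_def Let_def less_top[symmetric])
  then show ?thesis
    by (simp add: wick_algebra_def wick_algebra_at_def wick_pre_algebra_def
        real_analytic_mi_power_cnj C_infinity_mi_power_cnj)
qed

subsection \<open>Growth of the Taylor coefficients\<close>

text \<open>The fourth root of \<open>mi_fact N\<close>: the exponents 1/4, 1/2 and 3/4 of
  factorials become integer powers of \<open>qfact\<close>.\<close>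

definition qfact :: "'n::finite multiindex \<Rightarrow> real"
  where "qfact N = (\<Prod>i\<in>UNIV. root 4 (fact (N $ i)))"

lemma qfact_power4: "qfact N ^ 4 = real (mi_fact N)"
  by (simp add: qfact_def mi_fact_def prod_power_distrib real_root_pow_pos2)

lemma qfact_ge_1: "1 \<le> qfact N"
  unfolding qfact_def by (intro prod_ge_1) simp

lemma qfact_pos: "0 < qfact N"
  using qfact_ge_1[of N] by linarith

lemma qfact_add_le: "qfact (M + N) \<le> 2 ^ (mi_abs M + mi_abs N) * (qfact M * qfact N)"
proof -
  have "real (mi_fact (M + N)) \<le> real (2 ^ (mi_abs M + mi_abs N) * (mi_fact M * mi_fact N))"
    using mi_fact_add_le[of M N] by (rule of_nat_mono)
  also have "\<dots> \<le> (2 ^ (mi_abs M + mi_abs N)) ^ 4 * (real (mi_fact M) * real (mi_fact N))"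
    unfolding of_nat_mult of_nat_power of_nat_numeral
    by (intro mult_right_mono self_le_power) auto
  finally have "qfact (M + N) ^ 4 \<le> (2 ^ (mi_abs M + mi_abs N) * (qfact M * qfact N)) ^ 4"
    by (simp only: power_mult_distrib qfact_power4)
  then show ?thesis
    using qfact_pos[of M] qfact_pos[of N] qfact_pos[of "M + N"]
    by (subst (asm) power_mono_iff) auto
qed

lemma summable_power_div_root4_fact:
  assumes "0 \<le> y"
  shows "summable (\<lambda>k. y ^ k / root 4 (fact k))"
\<comment> \<open>From this threshold on, the ratio \<open>y / root 4 (Suc k)\<close> is at most
  1/2.\<close>
proof (rule summable_ratio_test[of "1 / 2" "nat \<lceil>(2 * y) ^ 4\<rceil>"])
  fix k assume "nat \<lceil>(2 * y) ^ 4\<rceil> \<le> k"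
  then have "(2 * y) ^ 4 \<le> real (Suc k)"
    by linarith
  then have "root 4 ((2 * y) ^ 4) \<le> root 4 (real (Suc k))"
    by (subst real_root_le_iff) auto
  moreover have "root 4 ((2 * y) ^ 4) = 2 * y"
    using assms by (intro real_root_power_cancel) auto
  ultimately have "2 * y \<le> root 4 (real (Suc k))"
    by (simp only:)
  then have "y ^ k / root 4 (fact k) * (y / root 4 (real (Suc k))) \<le> y ^ k / root 4 (fact k) * (1 / 2)"
    using assms by (intro mult_left_mono) (auto simp: field_simps simp del: of_nat_Suc)
  moreover have "root 4 (fact (Suc k)) = root 4 (real (Suc k)) * root 4 (fact k)"
    by (simp add: real_root_mult del: of_nat_Suc)
  ultimately show "norm (y ^ Suc k / root 4 (fact (Suc k))) \<le> 1 / 2 * norm (y ^ k / root 4 (fact k))"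
    using assms by (simp add: abs_mult mult_ac del: of_nat_Suc fact_Suc)
qed simp

lemma summable_on_power_div_qfact:
  assumes "0 \<le> y"
  shows "(\<lambda>N :: 'n::finite multiindex. y ^ mi_abs N / qfact N) summable_on UNIV"
  using summable_on_prod_vec[OF _ summable_power_div_root4_fact[OF assms], where 'n = 'n] assms
  by (simp add: qfact_def power_mi_abs prod_dividef)

lemma ennreal_le_infsum:
  fixes f :: "'i \<Rightarrow> ennreal"
  shows "f x \<le> infsum f UNIV"
proof -
  have "infsum f {x} \<le> infsum f UNIV"
    by (intro infsum_mono_neutral) (auto simp: nonneg_summable_on_complete)
  then show ?thesis by simp
qed

text \<open>All terms are nonnegative, so one term of each sum is kept: \<open>M\<close> as outer
  index, \<open>I = 0\<close> and \<open>J = M\<close> inside, then \<open>N\<close> in the level-0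
  series. The squares of both levels make the fourth power.\<close>

lemma wick_algebra_jet_bound:
  fixes f :: "complex ^ 'n::finite \<Rightarrow> complex"
  assumes h: "0 < hbar" and f: "f \<in> wick_algebra hbar"
  obtains x where "0 \<le> x" and "\<And>M N. (2 * hbar) ^ (2 * (mi_abs M + mi_abs N)) * norm (wirtinger M N f 0) ^ 4
    \<le> x * (real (mi_fact M) * real (mi_fact N) ^ 2)"
proof -
  define X where "X = wick_h 0 hbar f 1 1 0 0"
  have "wick_seminorm 0 hbar 1 1 0 0 f < \<infinity>"
    using f unfolding wick_algebra_def wick_algebra_at_def wick_pre_algebra_def by force
  then have X: "X \<noteq> \<infinity>"
    by (auto simp: wick_seminorm_def X_def Let_def split: if_splits)
  show thesis
  proof (rule that)
    show "0 \<le> enn2real X" by simp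
    fix M N :: "'n multiindex"
    define D where "D = norm (wirtinger M N f 0)"
    define u where "u = (2 * hbar) ^ (mi_abs M + mi_abs N) / real (mi_fact N) * D\<^sup>2"
    have u0: "0 \<le> u"
      using h by (simp add: u_def)
    have u: "ennreal u \<le> wick_h 0 hbar f 0 0 M 0"
      using ennreal_le_infsum[of "\<lambda>N. ennreal ((2 * hbar) ^ (mi_abs M + mi_abs (0 :: 'n multiindex) + mi_abs N)
        / real (mi_fact N) * (norm (wirtinger M (N + 0) f 0))\<^sup>2)" N]
      by (simp add: u_def D_def)
    define t where "t = (\<lambda>N :: 'n multiindex. ennreal (1 / real (mi_fact N)) *
      (\<Sum>I\<in>{..0}. \<Sum>J\<in>{..N + 0}. of_nat (mi_choose 0 I) * of_nat (mi_choose (N + 0) J)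
        * wick_h 0 hbar f 0 0 J I)\<^sup>2)"
    have "X = infsum t UNIV"
      \<comment> \<open>The level must appear as \<open>Suc 0\<close> for the recursion to unfold;
        \<open>l = 1\<close> is odd and selects the branch with exchanged indices.\<close>
      unfolding X_def One_nat_def wick_h.simps(2) t_def by simp
    then have "t M \<le> X"
      using ennreal_le_infsum[of t M] by simp
    have 0: "{..0 :: 'n multiindex} = {0}"
      by (auto simp: less_eq_vec_def vec_eq_iff)
    have "of_nat (mi_choose M M) * wick_h 0 hbar f 0 0 M 0
        \<le> (\<Sum>J\<in>{..M}. of_nat (mi_choose M J) * wick_h 0 hbar f 0 0 J 0)"
      by (rule member_le_sum) (auto simp: finite_atMost_multiindex)
    also have "\<dots> = (\<Sum>I\<in>{..0}. \<Sum>J\<in>{..M + 0}. of_nat (mi_choose 0 I) * of_nat (mi_choose (M + 0) J)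
        * wick_h 0 hbar f 0 0 J I)"
      by (simp add: 0 mi_choose_def del: wick_h.simps)
    finally have "ennreal u \<le> \<dots>"
      using u by (simp add: mi_choose_def del: wick_h.simps)
    then have "ennreal (1 / real (mi_fact M)) * (ennreal u)\<^sup>2 \<le> t M"
      unfolding t_def by (intro mult_left_mono power_mono) auto
    also note \<open>t M \<le> X\<close>
    also have "X = ennreal (enn2real X)"
      using X by (simp add: less_top)
    finally have "ennreal (1 / real (mi_fact M)) * (ennreal u)\<^sup>2 \<le> ennreal (enn2real X)" .
    moreover have "ennreal (1 / real (mi_fact M)) * (ennreal u)\<^sup>2 = ennreal (1 / real (mi_fact M) * u\<^sup>2)"
      using u0 by (simp add: ennreal_power ennreal_mult[symmetric])
    ultimately have "1 / real (mi_fact M) * u\<^sup>2 \<le> enn2real X"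
      by (simp only: ennreal_le_iff[OF enn2real_nonneg])
    then have "u\<^sup>2 \<le> enn2real X * real (mi_fact M)"
      by (simp add: field_simps)
    then have "u\<^sup>2 * real (mi_fact N) ^ 2 \<le> enn2real X * real (mi_fact M) * real (mi_fact N) ^ 2"
      by (rule mult_right_mono) simp
    moreover have "u\<^sup>2 * real (mi_fact N) ^ 2 = (2 * hbar) ^ (2 * (mi_abs M + mi_abs N)) * D ^ 4"
    proof -
      have "u * real (mi_fact N) = (2 * hbar) ^ (mi_abs M + mi_abs N) * D\<^sup>2"
        by (simp add: u_def)
      then have "(u * real (mi_fact N))\<^sup>2 = ((2 * hbar) ^ (mi_abs M + mi_abs N) * D\<^sup>2)\<^sup>2"
        by simp
      moreover have "D ^ 4 = (D\<^sup>2)\<^sup>2"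
        by (simp add: power_mult[symmetric])
      ultimately show ?thesis
        unfolding power_even_eq by (simp only: power_mult_distrib)
    qed
    ultimately show "(2 * hbar) ^ (2 * (mi_abs M + mi_abs N)) * norm (wirtinger M N f 0) ^ 4
        \<le> enn2real X * (real (mi_fact M) * real (mi_fact N) ^ 2)"
      by (simp add: D_def mult.assoc)
  qed
qed

text \<open>Passing from derivatives to coefficients divides the fourth power by
  \<open>qfact M ^ 16 * qfact N ^ 16\<close>, against \<open>qfact M ^ 4 * qfact N ^ 8\<close> on
  the right; fourth roots leave the exponents 3 and 2. The base is the fourth root of
  \<open>1 / (2 * hbar) ^ 2\<close>.\<close>

lemma wick_algebra_coeff_bound:
  fixes f :: "complex ^ 'n::finite \<Rightarrow> complex"
  assumes h: "0 < hbar" and f: "f \<in> wick_algebra hbar" and a: "has_pseries f a r"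
  obtains C where "0 \<le> C" and "\<And>M N. norm (a M N)
    \<le> C * (1 / sqrt (2 * hbar)) ^ (mi_abs M + mi_abs N) / (qfact M ^ 3 * qfact N ^ 2)"
proof -
  obtain x where "0 \<le> x" and x: "\<And>M N. (2 * hbar) ^ (2 * (mi_abs M + mi_abs N)) * norm (wirtinger M N f 0) ^ 4
    \<le> x * (real (mi_fact M) * real (mi_fact N) ^ 2)"
    using wick_algebra_jet_bound[OF h f] by blast
  show thesis
  proof (rule that)
    show C: "0 \<le> root 4 x"
      using \<open>0 \<le> x\<close> by simp
    fix M N :: "'n multiindex"
    define k where "k = mi_abs M + mi_abs N"
    define m n H where "m = qfact M" and "n = qfact N" and "H = (2 * hbar) ^ (2 * k)"
    have pos: "0 < m" "0 < n" "0 < H"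
      using h by (auto simp: m_def n_def H_def qfact_pos)
    have "norm (wirtinger M N f 0) = m ^ 4 * n ^ 4 * norm (a M N)"
      by (simp add: wirtinger_at_0[OF a] norm_mult m_def n_def qfact_power4)
    then have "H * (m ^ 4 * n ^ 4 * norm (a M N)) ^ 4 \<le> x * (m ^ 4 * (n ^ 4) ^ 2)"
      using x[of M N] by (simp add: H_def k_def m_def n_def qfact_power4)
    then have "(m ^ 4 * n ^ 8) * (norm (a M N) ^ 4 * (H * (m ^ 12 * n ^ 8))) \<le> (m ^ 4 * n ^ 8) * x"
      by (simp add: power_mult_distrib power_mult[symmetric] mult_ac power_add[symmetric])
    then have "norm (a M N) ^ 4 * (H * (m ^ 12 * n ^ 8)) \<le> x"
      using pos by (subst (asm) mult_le_cancel_left_pos) auto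
    then have "norm (a M N) ^ 4 \<le> x / (H * (m ^ 12 * n ^ 8))"
      using pos by (subst pos_le_divide_eq) auto
    also have "\<dots> = (root 4 x * (1 / sqrt (2 * hbar)) ^ k / (m ^ 3 * n ^ 2)) ^ 4"
    proof -
      have "((1 / sqrt (2 * hbar)) ^ k) ^ 4 = ((1 / sqrt (2 * hbar)) ^ 2) ^ (2 * k)"
        by (simp add: power_mult[symmetric] mult.commute)
      also have "\<dots> = 1 / H"
        using h by (simp add: H_def power_divide)
      finally show ?thesis
        using \<open>0 \<le> x\<close> by (simp add: power_divide power_mult_distrib power_mult[symmetric] real_root_pow_pos2)
    qed
    finally have "norm (a M N) \<le> root 4 x * (1 / sqrt (2 * hbar)) ^ k / (m ^ 3 * n ^ 2)"
      using pos h C by (subst (asm) power_mono_iff) auto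
    then show "norm (a M N) \<le> root 4 x * (1 / sqrt (2 * hbar)) ^ (mi_abs M + mi_abs N) / (qfact M ^ 3 * qfact N ^ 2)"
      by (simp add: k_def m_def n_def)
  qed
qed

text \<open>A factorial is a fourth power of \<open>qfact\<close>, so a holomorphic derivative
  leaves \<open>4 - 3 = 1\<close> power of \<open>qfact (P + N)\<close> and an antiholomorphic one
  \<open>4 - 2 = 2\<close> powers of \<open>qfact (Q + N)\<close>; \<open>qfact_add_le\<close>
  splits them. Its powers of 2, squared in the second case, fit under the common base 4.\<close>

lemma norm_pseries_diff_le:
  fixes a :: "'n::finite multiindex \<Rightarrow> 'n multiindex \<Rightarrow> complex"
  assumes C: "0 \<le> C" "0 \<le> k" and a: "\<And>M N. norm (a M N) \<le> C * k ^ (mi_abs M + mi_abs N) / (qfact M ^ 3 * qfact N ^ 2)"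
  shows "norm (pseries_diff N 0 a P Q) \<le> C * (4 * k) ^ (mi_abs P + mi_abs N + mi_abs Q) * qfact N / (qfact P * qfact Q)"
    and "norm (pseries_diff 0 N a P Q) \<le> C * (4 * k) ^ (mi_abs P + mi_abs N + mi_abs Q) * qfact N ^ 2 / (qfact P * qfact Q)"
proof -
  define p q n where "p = qfact P" and "q = qfact Q" and "n = qfact N"
  note defs = p_def q_def n_def
  have pos: "1 \<le> p" "1 \<le> q" "1 \<le> n"
    by (simp_all add: defs qfact_ge_1)
  define l where "l = mi_abs P + mi_abs N + mi_abs Q"
  \<comment> \<open>One power of \<open>qfact\<close> per index suffices for summation, and both
    bounds get the same denominator.\<close>
  have inv: "1 / p ^ 3 \<le> 1 / p" "1 / q ^ 2 \<le> 1 / q"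
    using pos by (auto intro!: divide_left_mono self_le_power mult_pos_pos)
  have two: "(2::real) ^ i \<le> 4 ^ l" "((2::real) ^ i) ^ 2 \<le> 4 ^ l" if "i \<le> l" for i
  proof -
    have "((2::real) ^ i) ^ 2 = (2 ^ 2) ^ i"
      by (simp only: power_mult[symmetric] mult.commute)
    then have "((2::real) ^ i) ^ 2 = 4 ^ i"
      by simp
    also have "\<dots> \<le> 4 ^ l"
      using that by (intro power_increasing) auto
    finally show "((2::real) ^ i) ^ 2 \<le> 4 ^ l" .
    moreover have "(2::real) ^ i \<le> (2 ^ i) ^ 2"
      by (intro self_le_power) auto
    ultimately show "(2::real) ^ i \<le> 4 ^ l"
      by simp
  qed
  have "norm (pseries_diff N 0 a P Q) = qfact (P + N) ^ 4 / p ^ 4 * norm (a (P + N) Q)"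
    by (simp add: pseries_diff_def norm_mult norm_divide qfact_power4 defs)
  also have "\<dots> \<le> qfact (P + N) ^ 4 / p ^ 4 * (C * k ^ l / (qfact (P + N) ^ 3 * q ^ 2))"
    using a[of "P + N" Q] pos by (intro mult_left_mono) (auto simp: defs l_def mi_abs_add qfact_pos)
  also have "\<dots> = C * k ^ l * qfact (P + N) * (1 / (p ^ 4 * q ^ 2))"
    using qfact_pos[of "P + N"] by (simp add: field_simps power4_eq_xxxx power3_eq_cube power2_eq_square)
  also have "\<dots> \<le> C * k ^ l * (4 ^ l * (p * n)) * (1 / (p ^ 4 * q ^ 2))"
  proof (intro mult_left_mono mult_right_mono)
    show "qfact (P + N) \<le> 4 ^ l * (p * n)"
      unfolding defs
      by (rule order_trans[OF qfact_add_le mult_right_mono[OF two(1)]]) (auto simp: l_def qfact_pos less_imp_le)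
  qed (use C pos in auto)
  also have "\<dots> = C * (4 * k) ^ l * n * (1 / p ^ 3 * (1 / q ^ 2))"
    using pos by (simp add: power_mult_distrib field_simps power4_eq_xxxx power3_eq_cube power2_eq_square)
  also have "\<dots> \<le> C * (4 * k) ^ l * n * (1 / p * (1 / q))"
    using C pos by (intro mult_left_mono mult_mono inv) auto
  finally show "norm (pseries_diff N 0 a P Q) \<le> C * (4 * k) ^ (mi_abs P + mi_abs N + mi_abs Q) * qfact N / (qfact P * qfact Q)"
    by (simp add: defs l_def)
  have "norm (pseries_diff 0 N a P Q) = qfact (Q + N) ^ 4 / q ^ 4 * norm (a P (Q + N))"
    by (simp add: pseries_diff_def norm_mult norm_divide qfact_power4 defs)
  also have "\<dots> \<le> qfact (Q + N) ^ 4 / q ^ 4 * (C * k ^ l / (p ^ 3 * qfact (Q + N) ^ 2))"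
    using a[of P "Q + N"] pos by (intro mult_left_mono) (auto simp: defs l_def mi_abs_add qfact_pos add_ac)
  also have "\<dots> = C * k ^ l * (qfact (Q + N)) ^ 2 * (1 / (q ^ 4 * p ^ 3))"
    using qfact_pos[of "Q + N"] by (simp add: field_simps power4_eq_xxxx power3_eq_cube power2_eq_square)
  also have "\<dots> \<le> C * k ^ l * (4 ^ l * (q * n) ^ 2) * (1 / (q ^ 4 * p ^ 3))"
  proof (intro mult_left_mono mult_right_mono)
    have "(qfact (Q + N)) ^ 2 \<le> (2 ^ (mi_abs Q + mi_abs N) * (q * n)) ^ 2"
      unfolding defs using qfact_pos[of "Q + N"] by (intro power_mono qfact_add_le) auto
    also have "\<dots> \<le> 4 ^ l * (q * n) ^ 2"
      unfolding power_mult_distrib[of "2 ^ (mi_abs Q + mi_abs N)"]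
      by (intro mult_right_mono two) (auto simp: l_def)
    finally show "(qfact (Q + N)) ^ 2 \<le> 4 ^ l * (q * n) ^ 2" .
  qed (use C pos in auto)
  also have "\<dots> = C * (4 * k) ^ l * n ^ 2 * (1 / p ^ 3 * (1 / q ^ 2))"
    using pos by (simp add: power_mult_distrib field_simps power4_eq_xxxx power3_eq_cube power2_eq_square)
  also have "\<dots> \<le> C * (4 * k) ^ l * n ^ 2 * (1 / p * (1 / q))"
    using C pos by (intro mult_left_mono mult_mono inv) auto
  finally show "norm (pseries_diff 0 N a P Q) \<le> C * (4 * k) ^ (mi_abs P + mi_abs N + mi_abs Q) * qfact N ^ 2 / (qfact P * qfact Q)"
    by (simp add: defs l_def)
qed

subsection \<open>The Wick product as a power series\<close>

lemma summable_on_mult_pairs: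
  fixes f :: "'a \<Rightarrow> real" and g :: "'b \<Rightarrow> real"
  assumes "f summable_on UNIV" "g summable_on UNIV" "\<And>x. 0 \<le> f x" "\<And>y. 0 \<le> g y"
  shows "(\<lambda>(x, y). f x * g y) summable_on UNIV"
proof -
  have "(\<lambda>(x, y). f x * g y) summable_on Sigma UNIV (\<lambda>_. UNIV)"
  proof (rule summable_on_SigmaI)
    fix x
    show "((\<lambda>y. case (x, y) of (x, y) \<Rightarrow> f x * g y) has_sum f x * infsum g UNIV) UNIV"
      using has_sum_cmult_right[OF has_sum_infsum[OF assms(2)]] by simp
  qed (use assms in \<open>auto intro: summable_on_cmult_left\<close>)
  then show ?thesis
    by simp
qed

text \<open>Nested in the order in which the product is summed: first \<open>(P2, Q2)\<close> of the
  second factor, then \<open>(P1, Q1)\<close> of the first, and last the index \<open>N\<close> of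
  the Wick series.\<close>

type_synonym 'n star_index =
  "('n multiindex \<times> ('n multiindex \<times> 'n multiindex)) \<times> ('n multiindex \<times> 'n multiindex)"

definition star_term :: "real \<Rightarrow> ('n::finite multiindex \<Rightarrow> 'n multiindex \<Rightarrow> complex) \<Rightarrow>
    ('n multiindex \<Rightarrow> 'n multiindex \<Rightarrow> complex) \<Rightarrow> 'n star_index \<Rightarrow> complex"
  where "star_term hbar a b = (\<lambda>((N, (P1, Q1)), (P2, Q2)).
    of_real ((2 * hbar) ^ mi_abs N / real (mi_fact N)) * pseries_diff N 0 a P1 Q1 * pseries_diff 0 N b P2 Q2)"

definition star_fibre :: "'n::finite multiindex \<Rightarrow> 'n multiindex \<Rightarrow> 'n star_index set"
  where "star_fibre P Q = {((N, (P1, Q1)), (P2, Q2)) | N P1 Q1 P2 Q2. P1 + P2 = P \<and> Q1 + Q2 = Q}"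

definition star_coeff :: "real \<Rightarrow> ('n::finite multiindex \<Rightarrow> 'n multiindex \<Rightarrow> complex) \<Rightarrow>
    ('n multiindex \<Rightarrow> 'n multiindex \<Rightarrow> complex) \<Rightarrow> 'n multiindex \<Rightarrow> 'n multiindex \<Rightarrow> complex"
  where "star_coeff hbar a b P Q = infsum (star_term hbar a b) (star_fibre P Q)"

lemma star_term_summable:
  fixes f g :: "complex ^ 'n::finite \<Rightarrow> complex"
  assumes h: "0 < hbar" and f: "f \<in> wick_algebra hbar" "has_pseries f a r"
    and g: "g \<in> wick_algebra hbar" "has_pseries g b s" and t: "0 \<le> t"
  shows "(\<lambda>((N, (P1, Q1)), (P2, Q2)). norm (star_term hbar a b ((N, (P1, Q1)), (P2, Q2)))
    * t ^ (mi_abs P1 + mi_abs Q1 + mi_abs P2 + mi_abs Q2)) summable_on UNIV"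
proof -
  define k where "k = 1 / sqrt (2 * hbar)"
  have k: "0 \<le> k" "2 * hbar * k\<^sup>2 = 1"
    using h by (auto simp: k_def power_divide)
  obtain C where C: "0 \<le> C" "\<And>M N. norm (a M N) \<le> C * k ^ (mi_abs M + mi_abs N) / (qfact M ^ 3 * qfact N ^ 2)"
    using wick_algebra_coeff_bound[OF h f] unfolding k_def by blast
  obtain D where D: "0 \<le> D" "\<And>M N. norm (b M N) \<le> D * k ^ (mi_abs M + mi_abs N) / (qfact M ^ 3 * qfact N ^ 2)"
    using wick_algebra_coeff_bound[OF h g] unfolding k_def by blast
  note A = norm_pseries_diff_le(1)[OF C(1) k(1) C(2)] and B = norm_pseries_diff_le(2)[OF D(1) k(1) D(2)]
  define y where "y = 4 * k * t"
  have y: "0 \<le> y"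
    using k t by (simp add: y_def)
  define G where "G z N = z ^ mi_abs N / qfact N" for z and N :: "'n multiindex"
  have G: "G z summable_on UNIV" "0 \<le> G z N" if "0 \<le> z" for z N
    unfolding G_def using that qfact_pos[of N] by (auto intro: summable_on_power_div_qfact)
  define H :: "'n multiindex \<times> 'n multiindex \<Rightarrow> real" where "H = (\<lambda>(P, Q). G y P * G y Q)"
  have H: "H summable_on UNIV" "0 \<le> H x" for x
    unfolding H_def using summable_on_mult_pairs[OF G(1)[OF y] G(1)[OF y]] G(2)[OF y]
    by (auto simp: case_prod_unfold)
  \<comment> \<open>The base 16 is \<open>2 * hbar * (4 * k) ^ 2\<close>: both factors contribute
    \<open>(4 * k) ^ mi_abs N\<close>, and \<open>2 * hbar * k ^ 2 = 1\<close>.\<close>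
  define J :: "'n multiindex \<times> ('n multiindex \<times> 'n multiindex) \<Rightarrow> real" where "J = (\<lambda>(N, x). G 16 N * H x)"
  have J: "J summable_on UNIV" "0 \<le> J x" for x
    unfolding J_def using summable_on_mult_pairs[OF G(1)[of 16] H(1)] G(2)[of 16] H(2)
    by (auto simp: case_prod_unfold)
  have "(\<lambda>(x1, x2). J x1 * H x2) summable_on UNIV"
    using J H by (intro summable_on_mult_pairs)
  then have S: "(\<lambda>x. C * D * (case x of (x1, x2) \<Rightarrow> J x1 * H x2)) summable_on UNIV"
    by (rule summable_on_cmult_right)
  have le: "norm (star_term hbar a b ((N, (P1, Q1)), (P2, Q2))) * t ^ (mi_abs P1 + mi_abs Q1 + mi_abs P2 + mi_abs Q2)
      \<le> C * D * (J (N, (P1, Q1)) * H (P2, Q2))" for N P1 Q1 P2 Q2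
  proof -
    define n m where "n = mi_abs N" and "m = mi_abs P1 + mi_abs Q1 + mi_abs P2 + mi_abs Q2"
    define q where "q = qfact N"
    define V where "V = qfact P1 * qfact Q1 * (qfact P2 * qfact Q2)"
    have pos: "0 < q" "0 < V"
      by (auto simp: q_def V_def qfact_pos)
    have "norm (star_term hbar a b ((N, (P1, Q1)), (P2, Q2)))
      = (2 * hbar) ^ n / q ^ 4 * (norm (pseries_diff N 0 a P1 Q1) * norm (pseries_diff 0 N b P2 Q2))"
      using h by (simp add: star_term_def norm_mult norm_divide norm_power n_def q_def qfact_power4)
    also have "\<dots> \<le> (2 * hbar) ^ n / q ^ 4 * (C * (4 * k) ^ (mi_abs P1 + mi_abs N + mi_abs Q1) * qfact N / (qfact P1 * qfact Q1)
        * (D * (4 * k) ^ (mi_abs P2 + mi_abs N + mi_abs Q2) * qfact N ^ 2 / (qfact P2 * qfact Q2)))"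
      using h pos C(1) D(1) k(1)
      by (intro mult_left_mono[OF mult_mono[OF A B]]) (auto simp: qfact_pos less_imp_le)
    also have "\<dots> = C * D * (((2 * hbar) ^ n * ((4 * k) ^ n * (4 * k) ^ n)) * (4 * k) ^ m / (q * V))"
      using pos by (simp add: n_def m_def q_def[symmetric] V_def power_add power4_eq_xxxx power2_eq_square mult_ac)
    also have "(2 * hbar) ^ n * ((4 * k) ^ n * (4 * k) ^ n) = 16 ^ n"
    proof -
      have "2 * hbar * (4 * k * (4 * k)) = 16"
        using k(2) by (simp add: power2_eq_square)
      then show ?thesis
        by (simp only: power_mult_distrib[symmetric])
    qed
    finally have "norm (star_term hbar a b ((N, (P1, Q1)), (P2, Q2))) * t ^ m
        \<le> C * D * (16 ^ n * (4 * k) ^ m / (q * V)) * t ^ m"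
      using t by (intro mult_right_mono) auto
    also have "\<dots> = C * D * (16 ^ n / q * (y ^ m / V))"
      by (simp add: y_def power_mult_distrib)
    also have "\<dots> = C * D * (J (N, (P1, Q1)) * H (P2, Q2))"
      by (simp add: J_def H_def G_def n_def m_def q_def V_def power_add mult_ac)
    finally show ?thesis
      by (simp add: m_def)
  qed
  have "norm (norm (star_term hbar a b x) * t ^ (mi_abs (fst (snd (fst x))) + mi_abs (snd (snd (fst x)))
      + mi_abs (fst (snd x)) + mi_abs (snd (snd x)))) \<le> C * D * (case x of (x1, x2) \<Rightarrow> J x1 * H x2)" for x
    using le[of "fst (fst x)" "fst (snd (fst x))" "snd (snd (fst x))" "fst (snd x)" "snd (snd x)"] t
    by (simp add: case_prod_unfold abs_mult)
  from Infinite_Sum.abs_summable_on_comparison_test'[OF S this] show ?thesis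
    using t by (simp add: case_prod_unfold abs_mult)
qed

text \<open>One absolutely summable family is summed in two ways: iteratively, which gives the
  series defining \<open>wick_star\<close>, and grouped by total exponents, which gives
  \<open>star_coeff\<close>.\<close>

lemma has_pseries_wick_star:
  fixes f g :: "complex ^ 'n::finite \<Rightarrow> complex"
  assumes h: "0 < hbar" and f: "f \<in> wick_algebra hbar" "has_pseries f a r"
    and g: "g \<in> wick_algebra hbar" "has_pseries g b s"
  shows "has_pseries (wick_star hbar f g) (star_coeff hbar a b) (min r s)"
  unfolding has_pseries_def
proof (intro conjI ballI)
  show "0 < min r s"
    using f(2) g(2) by (simp add: has_pseries_def)
  fix z :: "complex ^ 'n" assume "z \<in> polydisc (min r s)"
  then have z: "z \<in> polydisc r" "z \<in> polydisc s"
    by (auto simp: polydisc_def)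
  \<comment> \<open>Any bound on the coordinates of \<open>z\<close> serves here; \<open>r\<close>
    and \<open>s\<close> enter only through the expansions of the derivatives of \<open>f\<close>
    and \<open>g\<close>.\<close>
  define t where "t = norm z"
  have t: "norm (z $ i) \<le> t" for i
    by (simp add: t_def Finite_Cartesian_Product.norm_nth_le)
  then have t0: "0 \<le> t"
    by (simp add: t_def)
  define mon where "mon P Q = mi_power z P * mi_power (cnj_vec z) Q" for P Q
  have mon: "norm (mon P Q) \<le> t ^ (mi_abs P + mi_abs Q)" for P Q
    unfolding mon_def norm_mult power_add
    using t t0 by (intro mult_mono[OF norm_mi_power_le norm_mi_power_le]) auto
  define F where "F = (\<lambda>((N, (P1, Q1)), (P2, Q2)). star_term hbar a b ((N, (P1, Q1)), (P2, Q2)) * (mon P1 Q1 * mon P2 Q2))"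
  have "norm (F x) \<le> (\<lambda>((N, (P1, Q1)), (P2, Q2)). norm (star_term hbar a b ((N, (P1, Q1)), (P2, Q2)))
      * t ^ (mi_abs P1 + mi_abs Q1 + mi_abs P2 + mi_abs Q2)) x" for x
  proof -
    obtain N P1 Q1 P2 Q2 where x: "x = ((N, (P1, Q1)), (P2, Q2))"
      by (cases x) auto
    have "norm (mon P1 Q1 * mon P2 Q2) \<le> t ^ (mi_abs P1 + mi_abs Q1) * t ^ (mi_abs P2 + mi_abs Q2)"
      unfolding norm_mult using t0 by (intro mult_mono mon) auto
    then have "norm (F x) \<le> norm (star_term hbar a b x) * (t ^ (mi_abs P1 + mi_abs Q1) * t ^ (mi_abs P2 + mi_abs Q2))"
      unfolding F_def x split norm_mult[of "star_term _ _ _ _"] by (rule mult_left_mono) simp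
    then show ?thesis
      by (simp add: x power_add mult_ac)
  qed
  from Infinite_Sum.abs_summable_on_comparison_test'[OF star_term_summable[OF h f g t0] this]
  have "(\<lambda>x. norm (F x)) summable_on UNIV" .
  then have "F summable_on UNIV"
    by (rule abs_summable_summable)
  then obtain v where v: "(F has_sum v) UNIV"
    unfolding summable_on_def by (elim exE)
  define c where "c N = of_real ((2 * hbar) ^ mi_abs N / real (mi_fact N)) * wirtinger N 0 f z * wirtinger 0 N g z" for N
  have Wf: "((\<lambda>(P, Q). pseries_diff N 0 a P Q * mon P Q) has_sum wirtinger N 0 f z) UNIV" for N
    using has_pseriesD[OF has_pseries_wirtinger[OF f(2)] z(1)] by (simp add: mon_def mult.assoc)
  have Wg: "((\<lambda>(P, Q). pseries_diff 0 N b P Q * mon P Q) has_sum wirtinger 0 N g z) UNIV" for N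
    using has_pseriesD[OF has_pseries_wirtinger[OF g(2)] z(2)] by (simp add: mon_def mult.assoc)
  define c1 where "c1 = (\<lambda>(N, (P, Q)). of_real ((2 * hbar) ^ mi_abs N / real (mi_fact N))
    * (pseries_diff N 0 a P Q * mon P Q) * wirtinger 0 N g z)"
  have "(c1 has_sum v) UNIV"
  proof (rule has_sum_SigmaD[where f = F and B = "\<lambda>_. UNIV"])
    show "(F has_sum v) (Sigma UNIV (\<lambda>_. UNIV))"
      using v by simp
    fix x :: "'n multiindex \<times> ('n multiindex \<times> 'n multiindex)"
    obtain N P Q where x: "x = (N, (P, Q))"
      by (cases x) auto
    show "((\<lambda>y. F (x, y)) has_sum c1 x) UNIV"
      using has_sum_cmult_right[OF Wg[of N], of "of_real ((2 * hbar) ^ mi_abs N / real (mi_fact N))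
          * (pseries_diff N 0 a P Q * mon P Q)"]
      by (simp add: x F_def c1_def star_term_def case_prod_unfold mult_ac)
  qed
  have "(c has_sum v) UNIV"
  proof (rule has_sum_SigmaD[where f = c1 and B = "\<lambda>_. UNIV"])
    show "(c1 has_sum v) (Sigma UNIV (\<lambda>_. UNIV))"
      using \<open>(c1 has_sum v) UNIV\<close> by simp
    fix N
    show "((\<lambda>y. c1 (N, y)) has_sum c N) UNIV"
      using has_sum_cmult_left[OF has_sum_cmult_right[OF Wf[of N], of "of_real ((2 * hbar) ^ mi_abs N / real (mi_fact N))"],
          of "wirtinger 0 N g z"]
      by (simp add: c_def c1_def case_prod_unfold mult_ac)
  qed
  then have star: "wick_star hbar f g z = v"
    unfolding wick_star_def c_def by (rule infsumI)
  let ?\<sigma> = "\<lambda>((N, (P1, Q1)), (P2, Q2)). (P1 + P2, Q1 + Q2) :: 'n multiindex \<times> 'n multiindex"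
  \<comment> \<open>Tagging each index with its total exponents presents the index set as the
    disjoint union of the fibres, the shape needed for \<open>has_sum_SigmaD\<close>.\<close>
  have bij: "bij_betw (\<lambda>x. (?\<sigma> x, x)) UNIV (Sigma UNIV (\<lambda>(P, Q). star_fibre P Q))"
    by (rule bij_betwI[where g = snd]) (auto simp: star_fibre_def)
  show "((\<lambda>(P, Q). star_coeff hbar a b P Q * mi_power z P * mi_power (cnj_vec z) Q)
      has_sum wick_star hbar f g z) UNIV"
    unfolding star
  proof (rule has_sum_SigmaD[where f = "\<lambda>(q, x). F x" and B = "\<lambda>(P, Q). star_fibre P Q"])
    show "((\<lambda>(q, x). F x) has_sum v) (Sigma UNIV (\<lambda>(P, Q). star_fibre P Q))"
      using v by (subst has_sum_reindex_bij_betw[OF bij, symmetric]) simp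
    fix PQ :: "'n multiindex \<times> 'n multiindex"
    obtain P Q where PQ: "PQ = (P, Q)" by force
    have "(\<lambda>x. norm (star_term hbar a b x)) summable_on UNIV"
      \<comment> \<open>At \<open>t = 1\<close> the weight disappears.\<close>
      using star_term_summable[OF h f g, of 1] by (simp add: case_prod_unfold)
    then have "star_term hbar a b summable_on UNIV"
      by (rule abs_summable_summable)
    then have "star_term hbar a b summable_on star_fibre P Q"
      by (rule summable_on_subset_banach) simp
    then have "(star_term hbar a b has_sum star_coeff hbar a b P Q) (star_fibre P Q)"
      unfolding star_coeff_def by (rule has_sum_infsum)
    from has_sum_cmult_left[OF this, of "mon P Q"]
    have "((\<lambda>x. star_term hbar a b x * mon P Q) has_sum star_coeff hbar a b P Q * mon P Q) (star_fibre P Q)" .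
    moreover have "F x = star_term hbar a b x * mon P Q" if "x \<in> star_fibre P Q" for x
      using that by (auto simp: star_fibre_def F_def mon_def mi_power_add mult_ac)
    ultimately have "(F has_sum star_coeff hbar a b P Q * mon P Q) (star_fibre P Q)"
      using has_sum_cong[of "star_fibre P Q" F] by metis
    then show "((\<lambda>x. case (PQ, x) of (q, x) \<Rightarrow> F x) has_sum
        (case PQ of (P, Q) \<Rightarrow> star_coeff hbar a b P Q * mi_power z P * mi_power (cnj_vec z) Q))
        (case PQ of (P, Q) \<Rightarrow> star_fibre P Q)"
      by (simp add: PQ mon_def mult.assoc)
  qed
qed

subsection \<open>Injectivity of the representation\<close>

text \<open>\<open>Psi\<close> keeps the subfamily \<open>R = 0\<close> of an absolutely summable
  expansion, so its series converges on the same polydisc.\<close>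

lemma has_pseries_Psi:
  fixes g :: "complex ^ 'n::finite \<Rightarrow> complex"
  assumes g: "has_pseries g b r"
  shows "has_pseries (Psi g) (\<lambda>R S. if R = 0 then b 0 S else 0) r"
  unfolding has_pseries_def
proof (intro conjI ballI)
  show "0 < r"
    using g by (simp add: has_pseries_def)
  fix z :: "complex ^ 'n" assume "z \<in> polydisc r"
  let ?F = "\<lambda>(R, S). b R S * mi_power z R * mi_power (cnj_vec z) S"
  let ?h = "\<lambda>I :: 'n multiindex. (0 :: 'n multiindex, I)"
  have "?F summable_on UNIV"
    using has_pseriesD[OF g \<open>z \<in> polydisc r\<close>] by (rule has_sum_imp_summable)
  then have "?F summable_on range ?h"
    by (rule summable_on_subset_banach) simp
  then have v: "(?F has_sum infsum ?F (range ?h)) (range ?h)"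
    by (rule has_sum_infsum)
  then have "((\<lambda>I. b 0 I * mi_power (cnj_vec z) I) has_sum infsum ?F (range ?h)) UNIV"
    by (subst (asm) has_sum_reindex) (auto simp: inj_on_def o_def)
  then have "Psi g z = infsum ?F (range ?h)"
    unfolding Psi_def by (intro infsumI) (simp add: wirtinger_at_0[OF g])
  moreover have "((\<lambda>(R, S). (if R = 0 then b 0 S else 0) * mi_power z R * mi_power (cnj_vec z) S)
      has_sum infsum ?F (range ?h)) UNIV"
    using v by (rule iffD1[OF has_sum_cong_neutral, rotated -1]) (auto simp: image_iff)
  ultimately show "((\<lambda>(R, S). (if R = 0 then b 0 S else 0) * mi_power z R * mi_power (cnj_vec z) S)
      has_sum Psi g z) UNIV"
    by simp
qed

lemma wick_algebra_has_pseries: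
  assumes "f \<in> wick_algebra hbar"
  obtains a r where "has_pseries f a r"
  using real_analytic_has_pseries[of f 0] assms
  by (auto simp: wick_algebra_def wick_algebra_at_def)

text \<open>
  Pairing \<open>f\<close> with an element whose antiholomorphic part is \<open>cnj z\<close> to the power \<open>K\<close> isolates
  \<open>a K Q\<close> up to coefficients \<open>a N Q'\<close> with \<open>N\<close> strictly smaller than \<open>K\<close>.
\<close>

lemma star_coeff_0_eq:
  fixes a b :: "'n::finite multiindex \<Rightarrow> 'n multiindex \<Rightarrow> complex"
  assumes b: "\<And>S. b 0 S = (if S = K then 1 else 0)"
    and a: "\<And>N S. mi_abs N < mi_abs K \<Longrightarrow> a N S = 0"
  shows "star_coeff hbar a b 0 Q = of_real ((2 * hbar) ^ mi_abs K * real (mi_fact K)) * a K Q"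
proof -
  let ?x = "((K, (0, Q)), (0, 0)) :: 'n star_index"
  have "(star_term hbar a b has_sum star_term hbar a b ?x) (star_fibre 0 Q)"
  proof (rule has_sum_finite_neutralI[of "{?x}"])
    fix x assume x: "x \<in> star_fibre 0 Q - {?x}"
    then obtain N P1 Q1 P2 Q2 where x': "x = ((N, (P1, Q1)), (P2, Q2))" and "P1 + P2 = 0" and Q: "Q1 + Q2 = Q"
      by (auto simp: star_fibre_def)
    then have P: "P1 = 0" "P2 = 0"
      by (auto simp: vec_eq_iff)
    show "star_term hbar a b x = 0"
    \<comment> \<open>\<open>b\<close> contributes only for \<open>Q2 + N = K\<close>. Then
      \<open>Q2 = 0\<close> would give \<open>?x\<close>, and otherwise \<open>N\<close> is smaller
      than \<open>K\<close> and \<open>a\<close> vanishes.\<close>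
    proof (cases "Q2 + N = K")
      case False
      then show ?thesis
        by (simp add: x' P star_term_def pseries_diff_def b)
    next
      case True
      have "Q2 \<noteq> 0"
        using x x' P Q True by auto
      then have "mi_abs N < mi_abs K"
        using mi_abs_pos[of Q2] by (simp add: True[symmetric] mi_abs_add)
      then show ?thesis
        by (simp add: x' P star_term_def pseries_diff_def a)
    qed
  qed (auto simp: star_fibre_def)
  then have "star_coeff hbar a b 0 Q = star_term hbar a b ?x"
    unfolding star_coeff_def by (rule infsumI)
  then show ?thesis
    by (simp add: star_term_def pseries_diff_def b)
qed

theorem corollary6p3:
  fixes hbar :: real and f :: "complex ^ 'n::finite \<Rightarrow> complex"
  assumes "hbar > 0"
    and "f \<in> wick_algebra hbar"
    and "\<forall>u\<in>fock_space hbar. bargmann_fock hbar f u = (\<lambda>_. 0)"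
  shows "f = (\<lambda>_. 0)"
proof -
  obtain a r where f: "has_pseries f a r"
    using wick_algebra_has_pseries[OF assms(2)] .
  have "a K Q = 0" for K Q
  \<comment> \<open>\<open>Q\<close> stays arbitrary, because \<open>star_coeff_0_eq\<close> asks
    for \<open>a N S = 0\<close> at every \<open>S\<close>.\<close>
  proof (induction "mi_abs K" arbitrary: K Q rule: less_induct)
    case less
    define u where "u = Psi (\<lambda>z. mi_power (cnj_vec z) K)"
    have u: "u \<in> Psi ` wick_algebra hbar"
      unfolding u_def using mi_power_cnj_in_wick_algebra[OF assms(1)] by (rule imageI)
    define g where "g = inv_into (wick_algebra hbar) Psi u"
    have g: "g \<in> wick_algebra hbar" "Psi g = u"
      unfolding g_def by (rule inv_into_into[OF u], rule f_inv_into_f[OF u])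
    obtain b s where b: "has_pseries g b s"
      using wick_algebra_has_pseries[OF g(1)] .
    \<comment> \<open>\<open>g\<close> and the monomial have the same image \<open>u\<close> under
      \<open>Psi\<close>; uniqueness of coefficients compares the two expansions of
      \<open>u\<close>.\<close>
    have b0: "b 0 S = (if S = K then 1 else 0)" for S
      using fun_cong[OF fun_cong[OF has_pseries_unique[OF has_pseries_Psi[OF b, unfolded g(2)]
          has_pseries_Psi[OF has_pseries_mi_power_cnj[OF zero_less_one, of K], folded u_def]], of 0], of S]
      by simp
    have "bargmann_fock hbar f u = (\<lambda>_. 0)"
      using assms(3) u unfolding fock_space_def by blast
    then have "Psi (wick_star hbar f g) = (\<lambda>_. 0)"
      by (simp add: bargmann_fock_def g_def)
    with has_pseries_Psi[OF has_pseries_wick_star[OF assms(1,2) f g(1) b]]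
    have 1: "has_pseries (\<lambda>_. 0 :: complex) (\<lambda>R S. if R = 0 then star_coeff hbar a b 0 S else 0) (min r s)"
      by simp
    have 2: "has_pseries (\<lambda>_. 0 :: complex) (\<lambda>(R :: 'n multiindex) S. 0) 1"
      by (simp add: has_pseries_def case_prod_unfold)
    have "star_coeff hbar a b 0 Q = 0"
      using fun_cong[OF fun_cong[OF has_pseries_unique[OF 1 2], of 0], of Q] by simp
    moreover have "star_coeff hbar a b 0 Q = of_real ((2 * hbar) ^ mi_abs K * real (mi_fact K)) * a K Q"
      by (rule star_coeff_0_eq) (use b0 less in auto)
    ultimately show ?case
      using assms(1) by simp
  qed
  then have "wirtinger M N f 0 = 0" for M N
    by (simp add: wirtinger_at_0[OF f])
  moreover have "real_analytic f"
    using assms(2) by (simp add: wick_algebra_def wick_algebra_at_def)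
  ultimately show ?thesis
    by (intro real_analytic_identity)
qed

end
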